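(* The class of hyperbolic Monge–Ampère PDE is contact-invariant: the image of a hyperbolic Monge–Ampère PDE under a (local) contact transformation of $J^2(\mathbb{R}^2,\mathbb{R})$ is again a hyperbolic Monge–Ampère PDE.
   Context: $J^1=J^1(\mathbb{R}^2,\mathbb{R})$ has local coordinates $(x,y,z,p,q)$ and contact distribution $C=\{dz-p\,dx-q\,dy=0\}$, on which $\eta=dx\wedge dp+dy\wedge dq$ is a symplectic form defined up to scale. $J^2=J^2(\mathbb{R}^2,\mathbb{R})$ is the bundle $\pi^2_1:J^2\to J^1$ whose fibre over $\xi$ is the set $LG(C_\xi,[\eta])$ of 2-dimensional isotropic subspaces of $C_\xi$, with standard local coordinates $(x,y,z,p,q,r,s,t)$, where $(r,s,t)$ corresponds to the Lagrangian subspace spanned by $\partial_x+p\partial_z+r\partial_p+s\partial_q$ and $\partial_y+q\partial_z+s\partial_p+t\partial_q$ (so $p=z_x,q=z_y,r=z_{xx},s=z_{xy},t=z_{yy}$ on solutions). A contact transformation of $J^2$ is a (local) diffeomorphism preserving the canonical system $\{dz-p\,dx-q\,dy=dp-r\,dx-s\,dy=dq-s\,dx-t\,dy=0\}$. A PDE is a hypersurface $\Sigma=\{F(x,y,z,p,q,r,s,t)=0\}\subset J^2$ transverse to $\pi^2_1$ and such that $\pi^2_1|_\Sigma$ is a submersion. It is hyperbolic if $F_rF_t-\frac14F_s^2<0$ on $\Sigma$. It is Monge–Ampère if it is given, in standard coordinates, by an equation of the form $a(rt-s^2)+br+cs+dt+e=0$ with $a,b,c,d,e$ functions of $(x,y,z,p,q)$.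 *)

theory Defs
  imports "HOL-Analysis.Analysis"
begin

text \<open>
  A map is smooth on an open set if it is Frechet differentiable there and so, inductively, are all
  its directional derivatives; \<open>higher_differentiable_on\<close> is only meant to be used on open sets.
\<close>

primrec higher_differentiable_on ::
  "nat \<Rightarrow> 'a::real_normed_vector set \<Rightarrow> ('a \<Rightarrow> 'b::real_normed_vector) \<Rightarrow> bool" where
  "higher_differentiable_on 0 U f \<longleftrightarrow> continuous_on U f"
| "higher_differentiable_on (Suc n) U f \<longleftrightarrow>
     (\<forall>x\<in>U. f differentiable (at x)) \<and>
     (\<forall>v. higher_differentiable_on n U (\<lambda>x. frechet_derivative f (at x) v))"

definition smooth_on :: "'a::real_normed_vector set \<Rightarrow> ('a \<Rightarrow> 'b::real_normed_vector) \<Rightarrow> bool" where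
  "smooth_on U f \<longleftrightarrow> (\<forall>n. higher_differentiable_on n U f)"

definition diffeomorphism_between ::
  "'a::real_normed_vector set \<Rightarrow> 'b::real_normed_vector set \<Rightarrow> ('a \<Rightarrow> 'b) \<Rightarrow> bool" where
  "diffeomorphism_between U V f \<longleftrightarrow>
     open U \<and> open V \<and> (\<exists>g. homeomorphism U V f g \<and> smooth_on U f \<and> smooth_on V g)"

text \<open>
  Points of \<open>J\<^sup>1\<close> are \<open>(x, y, z, p, q)\<close>.  Points of \<open>J\<^sup>2\<close> are described in the standard coordinates
  as \<open>(\<xi>, r, s, t)\<close> with \<open>\<xi>\<close> in \<open>J\<^sup>1\<close>, so that the projection \<open>\<pi>\<^sup>2\<^sub>1\<close> is \<open>fst\<close>.
  Tangent vectors have the same types; \<open>(x', y', z', p', q')\<close> are the values of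
  \<open>dx, dy, dz, dp, dq\<close> on a tangent vector.
\<close>

type_synonym jet1 = "real \<times> real \<times> real \<times> real \<times> real"
type_synonym jet2 = "jet1 \<times> real \<times> real \<times> real"

fun contact_distribution :: "jet1 \<Rightarrow> jet1 set" where
  "contact_distribution (x, y, z, p, q) = {(x', y', z', p', q'). z' - p * x' - q * y' = 0}"

fun eta :: "jet1 \<Rightarrow> jet1 \<Rightarrow> real" where
  "eta (x1, y1, z1, p1, q1) (x2, y2, z2, p2, q2) =
     (x1 * p2 - x2 * p1) + (y1 * q2 - y2 * q1)"

definition lagrangian_planes :: "jet1 \<Rightarrow> jet1 set set" where
  "lagrangian_planes \<xi> = {L. subspace L \<and> dim L = 2 \<and> L \<subseteq> contact_distribution \<xi> \<and>
     (\<forall>u\<in>L. \<forall>v\<in>L. eta u v = 0)}"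

fun plane_of :: "jet2 \<Rightarrow> jet1 set" where
  "plane_of ((x, y, z, p, q), r, s, t) = span {(1, 0, p, r, s), (0, 1, q, s, t)}"

fun canonical_system :: "jet2 \<Rightarrow> jet2 set" where
  "canonical_system ((x, y, z, p, q), r, s, t) =
     {((x', y', z', p', q'), r', s', t').
        z' - p * x' - q * y' = 0 \<and> p' - r * x' - s * y' = 0 \<and> q' - s * x' - t * y' = 0}"

text \<open>
  The next three facts justify the coordinate description: \<open>(r, s, t)\<close> parametrizes bijectively the
  Lagrangian planes that project isomorphically to the \<open>(x, y)\<close>-plane, and the canonical system is
  the tautological one.
\<close>

lemma plane_of_explicit:
  "plane_of ((x, y, z, p, q), r, s, t) =
     {(a, b, p * a + q * b, r * a + s * b, s * a + t * b) | a b. True}"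
proof -
  have "(a, b, p * a + q * b, r * a + s * b, s * a + t * b) =
      a *\<^sub>R (1, 0, p, r, s) + b *\<^sub>R (0, 1, q, s, t)" for a b
    by (simp add: algebra_simps)
  then show ?thesis
    by (auto simp: span_insert span_singleton algebra_simps)
qed

declare plane_of.simps [simp del]

lemma canonical_system_tautological: "v \<in> canonical_system \<sigma> \<longleftrightarrow> fst v \<in> plane_of \<sigma>"
proof -
  obtain x y z p q r s t where "\<sigma> = ((x, y, z, p, q), r, s, t)"
    by (metis prod.collapse)
  moreover obtain x' y' z' p' q' r' s' t' where "v = ((x', y', z', p', q'), r', s', t')"
    by (metis prod.collapse)
  ultimately show ?thesis
    by (simp add: plane_of_explicit) (auto simp: algebra_simps)
qed

lemma lagrangian_plane_coordinates:
  "L \<in> lagrangian_planes \<xi> \<and> (\<forall>p q. (0, 0, 0, p, q) \<in> L \<longrightarrow> p = 0 \<and> q = 0) \<longleftrightarrow>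
   (\<exists>!w. L = plane_of (\<xi>, w))"
  (is "?lhs \<longleftrightarrow> ?rhs")
proof -
  obtain x y z p q where \<xi>: "\<xi> = (x, y, z, p, q)"
    by (metis prod.collapse)
  have uniq: "w = w'" if "plane_of (\<xi>, w) = plane_of (\<xi>, w')" for w w'
  proof -
    obtain r s t r' s' t' where w: "w = (r, s, t)" "w' = (r', s', t')"
      by (metis prod.collapse)
    have "(1, 0, p, r, s) \<in> plane_of (\<xi>, w)" "(0, 1, q, s, t) \<in> plane_of (\<xi>, w)"
      unfolding \<xi> w plane_of.simps by (auto simp: span_base)
    then show ?thesis
      unfolding that unfolding \<xi> w plane_of_explicit by auto
  qed
  have dim: "dim (plane_of (\<xi>, r, s, t)) = 2" for r s t
  proof -
    let ?B = "{(1, 0, p, r, s), (0, 1, q, s, t)} :: jet1 set"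
    have "independent ?B"
      by (auto simp: independent_insert span_singleton zero_prod_def)
    then have "dim (span ?B) = card ?B"
      by (rule dim_span_eq_card_independent)
    then show ?thesis by (simp add: \<xi> plane_of.simps)
  qed
  have sub: "subspace (plane_of (\<xi>, r, s, t))" for r s t
    by (simp add: \<xi> plane_of.simps subspace_span)
  have "?lhs" if "L = plane_of (\<xi>, r, s, t)" for r s t
    using that dim[of r s t] sub[of r s t] unfolding lagrangian_planes_def \<xi>
    by (auto simp: plane_of_explicit algebra_simps)
  moreover have "\<exists>r s t. L = plane_of (\<xi>, r, s, t)" if lhs: ?lhs
  proof -
    let ?f = "\<lambda>u :: jet1. (fst u, fst (snd u))"
    have lin: "linear ?f" by (auto intro!: linearI)
    have L: "subspace L" "dim L = 2" "L \<subseteq> contact_distribution \<xi>"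
      and iso: "\<And>u v. u \<in> L \<Longrightarrow> v \<in> L \<Longrightarrow> eta u v = 0"
      using lhs by (auto simp: lagrangian_planes_def)
    have "u = 0" if "u \<in> L" "?f u = 0" for u
      using that L(3) lhs unfolding \<xi> by (cases u) (fastforce simp: zero_prod_def)
    then have "inj_on ?f (span L)"
      using linear_inj_on_iff_eq_0[OF lin, of "span L"] L(1) by (simp add: span_eq_iff[THEN iffD2])
    then have "dim (?f ` L) = 2"
      using dim_image_eq[OF lin] L(2) by simp
    then have "?f ` L = UNIV"
      using dim_eq_full[of "?f ` L"] linear_subspace_image[OF lin L(1)]
      by (simp add: span_eq_iff[THEN iffD2])
    then have "(1, 0) \<in> ?f ` L" "(0, 1) \<in> ?f ` L" by simp_all
    then obtain z1 p1 q1 z2 p2 q2 where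
      uv: "(1, 0, z1, p1, q1) \<in> L" "(0, 1, z2, p2, q2) \<in> L"
      by force
    have "z1 = p" "z2 = q"
      using subsetD[OF L(3) uv(1)] subsetD[OF L(3) uv(2)] by (simp_all add: \<xi>)
    moreover have "p2 = q1"
      using iso[OF uv] by simp
    ultimately have "plane_of (\<xi>, p1, q1, q2) \<subseteq> L"
      using uv L(1) unfolding \<xi> plane_of.simps by (intro span_minimal) simp_all
    then have "plane_of (\<xi>, p1, q1, q2) = L"
      using subspace_dim_equal[of "plane_of (\<xi>, p1, q1, q2)" L] L dim sub by simp
    then show ?thesis by blast
  qed
  ultimately have "?lhs \<longleftrightarrow> (\<exists>w. L = plane_of (\<xi>, w))"
    by (metis prod_cases3)
  then show ?thesis
    using uniq by blast
qed

text \<open>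
  A local contact transformation: a diffeomorphism between open sets of \<open>J\<^sup>2\<close> whose differential
  maps the canonical system onto itself.
\<close>

definition contact_transformation :: "jet2 set \<Rightarrow> jet2 set \<Rightarrow> (jet2 \<Rightarrow> jet2) \<Rightarrow> bool" where
  "contact_transformation U V \<phi> \<longleftrightarrow>
     diffeomorphism_between U V \<phi> \<and>
     (\<forall>\<sigma>\<in>U. frechet_derivative \<phi> (at \<sigma>) ` canonical_system \<sigma> = canonical_system (\<phi> \<sigma>))"

text \<open>
  \<open>local_equation W F S\<close>: on the open set \<open>W\<close>, the set \<open>S\<close> is the smooth hypersurface \<open>F = 0\<close>,
  with \<open>dF \<noteq> 0\<close> along it, so that its tangent spaces are the kernels of \<open>dF\<close>.
\<close>

definition local_equation :: "jet2 set \<Rightarrow> (jet2 \<Rightarrow> real) \<Rightarrow> jet2 set \<Rightarrow> bool" where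
  "local_equation W F S \<longleftrightarrow>
     open W \<and> smooth_on W F \<and> S \<inter> W = {\<sigma>\<in>W. F \<sigma> = 0} \<and>
     (\<forall>\<sigma>\<in>S \<inter> W. \<exists>v. frechet_derivative F (at \<sigma>) v \<noteq> 0)"

definition equation_tangent :: "(jet2 \<Rightarrow> real) \<Rightarrow> jet2 \<Rightarrow> jet2 set" where
  "equation_tangent F \<sigma> = {v. frechet_derivative F (at \<sigma>) v = 0}"

definition vertical :: "jet2 set" where
  "vertical = {v. fst v = 0}"

text \<open>
  As the theory is local, all conditions on a PDE are imposed near each of its points.  The last two
  conditions of \<open>is_pde\<close> are transversality to the fibres of the projection to \<open>J\<^sup>1\<close> and
  surjectivity of the differential of the restricted projection.
\<close>

definition is_pde :: "jet2 set \<Rightarrow> bool" where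
  "is_pde S \<longleftrightarrow> (\<forall>\<sigma>\<in>S. \<exists>W F. \<sigma> \<in> W \<and> local_equation W F S \<and>
     (\<forall>\<tau>\<in>S \<inter> W. {u + v | u v. u \<in> equation_tangent F \<tau> \<and> v \<in> vertical} = UNIV \<and>
        fst ` equation_tangent F \<tau> = UNIV))"

definition F_r :: "(jet2 \<Rightarrow> real) \<Rightarrow> jet2 \<Rightarrow> real" where
  "F_r F \<sigma> = frechet_derivative F (at \<sigma>) (0, 1, 0, 0)"

definition F_s :: "(jet2 \<Rightarrow> real) \<Rightarrow> jet2 \<Rightarrow> real" where
  "F_s F \<sigma> = frechet_derivative F (at \<sigma>) (0, 0, 1, 0)"

definition F_t :: "(jet2 \<Rightarrow> real) \<Rightarrow> jet2 \<Rightarrow> real" where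
  "F_t F \<sigma> = frechet_derivative F (at \<sigma>) (0, 0, 0, 1)"

text \<open>
  Two local equations of the same hypersurface have proportional differentials along it, so the sign
  condition does not depend on the choice of \<open>F\<close>.
\<close>

definition is_hyperbolic :: "jet2 set \<Rightarrow> bool" where
  "is_hyperbolic S \<longleftrightarrow> (\<forall>\<sigma>\<in>S. \<exists>W F. \<sigma> \<in> W \<and> local_equation W F S \<and>
     (\<forall>\<tau>\<in>S \<inter> W. F_r F \<tau> * F_t F \<tau> - 1/4 * (F_s F \<tau>)\<^sup>2 < 0))"

text \<open>The coefficients are smooth functions on the open set \<open>fst ` W\<close> of \<open>J\<^sup>1\<close>.\<close>

definition is_monge_ampere :: "jet2 set \<Rightarrow> bool" where
  "is_monge_ampere S \<longleftrightarrow> (\<forall>\<sigma>\<in>S. \<exists>W a b c d e. \<sigma> \<in> W \<and> open W \<and>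
     smooth_on (fst ` W) a \<and> smooth_on (fst ` W) b \<and> smooth_on (fst ` W) c \<and>
     smooth_on (fst ` W) d \<and> smooth_on (fst ` W) e \<and>
     S \<inter> W = {(\<xi>, r, s, t). (\<xi>, r, s, t) \<in> W \<and>
       a \<xi> * (r * t - s\<^sup>2) + b \<xi> * r + c \<xi> * s + d \<xi> * t + e \<xi> = 0})"

definition hyperbolic_monge_ampere_pde :: "jet2 set \<Rightarrow> bool" where
  "hyperbolic_monge_ampere_pde S \<longleftrightarrow> is_pde S \<and> is_hyperbolic S \<and> is_monge_ampere S"

end

theory Submission
  imports Defs
begin

text \<open>
  The contact forms \<open>dp - r dx - s dy\<close>, \<open>dq - s dx - t dy\<close> give the canonical system a Levi form with
  values in a plane.  A contact map preserves it up to a linear map of that plane, hence preserves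
  the vectors whose contraction with it has rank at most one; these are exactly the vertical vectors
  with \<open>rt = s\<^sup>2\<close>.  They span the vertical space, so the map covers, locally, a map \<open>\<psi>\<close> of \<open>J\<^sup>1\<close> and
  sends the plane of a point of \<open>J\<^sup>2\<close> to its image under \<open>d\<psi>\<close>.  A Monge-Ampere equation says that
  a two-form vanishes on these planes, so its image is given by the pulled back two-form.
  Hyperbolicity means that \<open>dF\<close> kills two independent vectors of the cone \<open>rt = s\<^sup>2\<close> but not the whole
  vertical space; it is therefore invariant, and it implies transversality to the fibres.
\<close>

section \<open>Smooth maps and the symmetry of second derivatives\<close>

lemma higher_differentiable_on_pred:
  "higher_differentiable_on (Suc n) U f \<Longrightarrow> higher_differentiable_on n U f"
proof (induction n arbitrary: f)
  case 0
  then show ?case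
    by (simp add: continuous_at_imp_continuous_on differentiable_imp_continuous_within)
next
  case (Suc n)
  then show ?case
    by (metis higher_differentiable_on.simps(2))
qed

lemma higher_differentiable_on_subset:
  "higher_differentiable_on n U f \<Longrightarrow> V \<subseteq> U \<Longrightarrow> higher_differentiable_on n V f"
  by (induction n arbitrary: f) (auto intro: continuous_on_subset)

lemma higher_differentiable_on_cong:
  assumes "open U" "\<And>x. x \<in> U \<Longrightarrow> f x = g x" "higher_differentiable_on n U f"
  shows "higher_differentiable_on n U g"
  using assms(2,3)
proof (induction n arbitrary: f g)
  case 0
  then show ?case by (simp cong: continuous_on_cong)
next
  case (Suc n)
  have "g differentiable (at x)" if "x \<in> U" for x
    using has_derivative_transform_within_open[where f = f and g = g, OF _ assms(1) that]
      Suc.prems that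
    unfolding higher_differentiable_on.simps(2) differentiable_def by blast
  moreover have "frechet_derivative f (at x) v = frechet_derivative g (at x) v" if "x \<in> U" for x v
    using frechet_derivative_transform_within_open[OF _ assms(1) that Suc.prems(1)] Suc.prems(2) that
    by simp
  ultimately show ?case
    using Suc.IH[of "\<lambda>x. frechet_derivative f (at x) v" "\<lambda>x. frechet_derivative g (at x) v" for v]
      Suc.prems(2) by simp
qed

text \<open>The derivative may be given by any explicit formula, so each closure rule below is an
  induction whose step is the matching differentiation rule.\<close>

lemma higher_differentiable_on_SucI:
  assumes "open U"
    and "\<And>x. x \<in> U \<Longrightarrow> (f has_derivative f' x) (at x)"
    and "\<And>v. higher_differentiable_on n U (\<lambda>x. f' x v)"
  shows "higher_differentiable_on (Suc n) U f"
proof -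
  have "f' x v = frechet_derivative f (at x) v" if "x \<in> U" for x v
    using assms(2)[OF that] by (metis frechet_derivative_at)
  then have "higher_differentiable_on n U (\<lambda>x. frechet_derivative f (at x) v)" for v
    using assms(3) by (rule higher_differentiable_on_cong[OF assms(1)])
  then show ?thesis
    using assms(2) by (auto simp: differentiable_def)
qed

lemma higher_differentiable_on_SucD:
  assumes "higher_differentiable_on (Suc n) U f"
  shows "x \<in> U \<Longrightarrow> (f has_derivative frechet_derivative f (at x)) (at x)"
    and "higher_differentiable_on n U (\<lambda>x. frechet_derivative f (at x) v)"
  using assms by (auto simp: frechet_derivative_works)

lemma higher_differentiable_on_const:
  "open U \<Longrightarrow> higher_differentiable_on n U (\<lambda>x. c)"
  by (induction n arbitrary: c) (auto simp: frechet_derivative_const)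

lemma higher_differentiable_on_bounded_linear:
  assumes "open U" "bounded_linear L" "higher_differentiable_on n U f"
  shows "higher_differentiable_on n U (\<lambda>x. L (f x))"
  using assms(3)
proof (induction n arbitrary: f)
  case 0
  then show ?case
    using assms(2) by (simp add: bounded_linear.continuous_on)
next
  case (Suc n)
  show ?case
    by (rule higher_differentiable_on_SucI[OF assms(1)
          bounded_linear.has_derivative[OF assms(2) higher_differentiable_on_SucD(1)[OF Suc.prems]]])
      (auto intro: Suc.IH higher_differentiable_on_SucD[OF Suc.prems])
qed

lemma higher_differentiable_on_add:
  assumes "open U" "higher_differentiable_on n U f" "higher_differentiable_on n U g"
  shows "higher_differentiable_on n U (\<lambda>x. f x + g x)"
  using assms(2,3)
proof (induction n arbitrary: f g)
  case 0
  then show ?case by (simp add: continuous_on_add)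
next
  case (Suc n)
  show ?case
    by (rule higher_differentiable_on_SucI[OF assms(1) has_derivative_add[OF
          higher_differentiable_on_SucD(1)[OF Suc.prems(1)] higher_differentiable_on_SucD(1)[OF Suc.prems(2)]]])
      (auto intro: Suc.IH higher_differentiable_on_SucD[OF Suc.prems(1)] higher_differentiable_on_SucD[OF Suc.prems(2)])
qed

lemma higher_differentiable_on_sum:
  assumes "open U" "finite I" "\<And>i. i \<in> I \<Longrightarrow> higher_differentiable_on n U (f i)"
  shows "higher_differentiable_on n U (\<lambda>x. \<Sum>i\<in>I. f i x)"
  using assms(2,3)
  by (induction I rule: finite_induct)
    (auto simp: higher_differentiable_on_const[OF assms(1)] intro!: higher_differentiable_on_add[OF assms(1)])

text \<open>One Leibniz rule serves both products and scalar multiples. Each term of the derivative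
  pairs a derivative of one factor with the other factor, which is of order \<open>n\<close> by
  \<open>higher_differentiable_on_pred\<close>.\<close>

lemma higher_differentiable_on_bilinear:
  assumes "open U" "bounded_bilinear B" "higher_differentiable_on n U f" "higher_differentiable_on n U g"
  shows "higher_differentiable_on n U (\<lambda>x. B (f x) (g x))"
  using assms(3,4)
proof (induction n arbitrary: f g)
  case 0
  then show ?case using assms(2) by (simp add: bounded_bilinear.continuous_on)
next
  case (Suc n)
  show ?case
    by (rule higher_differentiable_on_SucI[OF assms(1) bounded_bilinear.FDERIV[OF assms(2)
          higher_differentiable_on_SucD(1)[OF Suc.prems(1)] higher_differentiable_on_SucD(1)[OF Suc.prems(2)]]])
      (auto intro!: Suc.IH higher_differentiable_on_add[OF assms(1)]
        intro: higher_differentiable_on_SucD[OF Suc.prems(1)]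
        higher_differentiable_on_SucD[OF Suc.prems(2)] higher_differentiable_on_pred[OF Suc.prems(1)]
        higher_differentiable_on_pred[OF Suc.prems(2)])
qed

lemma linear_eq_sum_Basis:
  fixes L :: "'a::euclidean_space \<Rightarrow> 'b::real_vector"
  assumes "linear L"
  shows "L v = (\<Sum>b\<in>Basis. (v \<bullet> b) *\<^sub>R L b)"
  by (metis (no_types, lifting) assms euclidean_representation linear_scale linear_sum sum.cong)

text \<open>In the chain rule both the base point and the argument of the derivative of
  \<open>f\<close> vary. Expanding the argument in a basis leaves directional derivatives of
  \<open>f\<close> composed with \<open>g\<close>, to which the induction hypothesis applies; hence
  only \<open>f\<close> is generalized.\<close>

lemma higher_differentiable_on_compose:
  fixes g :: "'a::real_normed_vector \<Rightarrow> 'b::euclidean_space"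
  assumes "open U" "g ` U \<subseteq> W"
    and "higher_differentiable_on n W f" "higher_differentiable_on n U g"
  shows "higher_differentiable_on n U (\<lambda>x. f (g x))"
  using assms(3,4)
proof (induction n arbitrary: f)
  case 0
  then show ?case
    using assms(2) by (auto intro: continuous_on_compose2)
next
  case (Suc n)
  let ?D = "\<lambda>x v. \<Sum>b\<in>Basis. (frechet_derivative g (at x) v \<bullet> b) *\<^sub>R frechet_derivative f (at (g x)) b"
  show ?case
  proof (rule higher_differentiable_on_SucI[OF assms(1)])
    fix x assume x: "x \<in> U"
    have f: "(f has_derivative frechet_derivative f (at (g x))) (at (g x))"
      using x assms(2) by (intro higher_differentiable_on_SucD(1)[OF Suc.prems(1)]) auto
    have "((\<lambda>x. f (g x)) has_derivative
        (\<lambda>v. frechet_derivative f (at (g x)) (frechet_derivative g (at x) v))) (at x)"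
      using diff_chain_at[OF higher_differentiable_on_SucD(1)[OF Suc.prems(2) x] f]
      by (simp add: o_def)
    then show "((\<lambda>x. f (g x)) has_derivative ?D x) (at x)"
      by (simp only: linear_eq_sum_Basis[OF has_derivative_linear[OF f], symmetric])
  next
    fix v
    show "higher_differentiable_on n U (\<lambda>x. ?D x v)"
      by (intro higher_differentiable_on_sum higher_differentiable_on_bilinear[OF _ bounded_bilinear_scaleR]
          higher_differentiable_on_bounded_linear[OF _ bounded_linear_inner_left] Suc.IH assms(1) finite_Basis
          higher_differentiable_on_SucD(2)[OF Suc.prems(1)] higher_differentiable_on_SucD(2)[OF Suc.prems(2)]
          higher_differentiable_on_pred[OF Suc.prems(2)])
  qed
qed

lemma higher_differentiable_on_id: "open U \<Longrightarrow> higher_differentiable_on n U (\<lambda>x. x)"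
  by (induction n) (auto simp: continuous_on_id higher_differentiable_on_const frechet_derivative_ident)

lemma smooth_on_id: "open U \<Longrightarrow> smooth_on U (\<lambda>x. x)"
  by (simp add: smooth_on_def higher_differentiable_on_id)

lemma smooth_on_const: "open U \<Longrightarrow> smooth_on U (\<lambda>x. c)"
  by (simp add: smooth_on_def higher_differentiable_on_const)

lemma smooth_on_subset: "smooth_on U f \<Longrightarrow> V \<subseteq> U \<Longrightarrow> smooth_on V f"
  by (meson smooth_on_def higher_differentiable_on_subset)

lemma smooth_on_cong:
  "open U \<Longrightarrow> (\<And>x. x \<in> U \<Longrightarrow> f x = g x) \<Longrightarrow> smooth_on U f \<Longrightarrow> smooth_on U g"
  unfolding smooth_on_def by (blast intro: higher_differentiable_on_cong)

lemma smooth_on_bounded_linear: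
  "open U \<Longrightarrow> bounded_linear L \<Longrightarrow> smooth_on U f \<Longrightarrow> smooth_on U (\<lambda>x. L (f x))"
  by (simp add: smooth_on_def higher_differentiable_on_bounded_linear)

lemma smooth_on_add:
  "open U \<Longrightarrow> smooth_on U f \<Longrightarrow> smooth_on U g \<Longrightarrow> smooth_on U (\<lambda>x. f x + g x)"
  by (simp add: smooth_on_def higher_differentiable_on_add)

lemma smooth_on_diff:
  "open U \<Longrightarrow> smooth_on U f \<Longrightarrow> smooth_on U g \<Longrightarrow> smooth_on U (\<lambda>x. f x - g x)"
  using smooth_on_add[of U f "\<lambda>x. - g x"]
    smooth_on_bounded_linear[where U = U and f = g, OF _ bounded_linear_minus[OF bounded_linear_ident]]
  by simp

lemma smooth_on_bilinear:
  "open U \<Longrightarrow> bounded_bilinear B \<Longrightarrow> smooth_on U f \<Longrightarrow> smooth_on U g \<Longrightarrow> smooth_on U (\<lambda>x. B (f x) (g x))"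
  by (simp add: smooth_on_def higher_differentiable_on_bilinear)

lemma smooth_on_compose:
  fixes g :: "'a::real_normed_vector \<Rightarrow> 'b::euclidean_space"
  shows "open U \<Longrightarrow> g ` U \<subseteq> W \<Longrightarrow> smooth_on W f \<Longrightarrow> smooth_on U g \<Longrightarrow> smooth_on U (\<lambda>x. f (g x))"
  by (simp add: smooth_on_def higher_differentiable_on_compose)

lemma smooth_on_has_derivative:
  "smooth_on U f \<Longrightarrow> x \<in> U \<Longrightarrow> (f has_derivative frechet_derivative f (at x)) (at x)"
  by (meson smooth_on_def higher_differentiable_on_SucD(1))

lemma smooth_on_frechet_derivative:
  "smooth_on U f \<Longrightarrow> smooth_on U (\<lambda>x. frechet_derivative f (at x) v)"
  unfolding smooth_on_def by (blast intro: higher_differentiable_on_SucD(2))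

lemma smooth_on_imp_continuous_on: "smooth_on U f \<Longrightarrow> continuous_on U f"
  by (metis smooth_on_def higher_differentiable_on.simps(1))

lemma frechet_derivative_bounded_linear:
  assumes "bounded_linear L" "f differentiable (at x)"
  shows "frechet_derivative (\<lambda>x. L (f x)) (at x) v = L (frechet_derivative f (at x) v)"
  using bounded_linear.has_derivative[OF assms(1) iffD1[OF frechet_derivative_works assms(2)]]
  by (metis frechet_derivative_at)

text \<open>Two applications of the mean value theorem, first in direction \<open>v\<close>, then in direction \<open>w\<close>.\<close>

lemma second_difference:
  fixes f :: "'a::real_normed_vector \<Rightarrow> real"
  assumes sm: "smooth_on U f" and h: "0 < h"
    and U: "\<And>s t. 0 \<le> s \<Longrightarrow> s \<le> h \<Longrightarrow> 0 \<le> t \<Longrightarrow> t \<le> h \<Longrightarrow> x + s *\<^sub>R v + t *\<^sub>R w \<in> U"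
  shows "\<exists>s t. 0 \<le> s \<and> s \<le> h \<and> 0 \<le> t \<and> t \<le> h \<and>
    f (x + h *\<^sub>R v + h *\<^sub>R w) - f (x + h *\<^sub>R v) - f (x + h *\<^sub>R w) + f x =
    h * h * frechet_derivative (\<lambda>y. frechet_derivative f (at y) v) (at (x + s *\<^sub>R v + t *\<^sub>R w)) w"
proof -
  let ?P = "\<lambda>s t. x + s *\<^sub>R v + t *\<^sub>R w"
  let ?D = "\<lambda>y. frechet_derivative f (at y) v"
  have line: "((\<lambda>s. k (c + s *\<^sub>R u)) has_real_derivative frechet_derivative k (at (c + s *\<^sub>R u)) u) (at s)"
    if "smooth_on U k" "c + s *\<^sub>R u \<in> U" for k :: "'a \<Rightarrow> real" and c u s
  proof -
    have k: "(k has_derivative frechet_derivative k (at (c + s *\<^sub>R u))) (at (c + s *\<^sub>R u))"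
      using that by (rule smooth_on_has_derivative)
    have "((\<lambda>s. c + s *\<^sub>R u) has_derivative (\<lambda>h. h *\<^sub>R u)) (at s)"
      by (auto intro!: derivative_eq_intros)
    from diff_chain_at[OF this k] show ?thesis
      unfolding o_def has_field_derivative_def linear_scale[OF has_derivative_linear[OF k]]
      by (simp add: mult_commute_abs)
  qed
  \<comment> \<open>The first mean value theorem concerns the increment in direction
    \<open>w\<close>, as a function of the position along \<open>v\<close>.\<close>
  have "\<exists>s>0. s < h \<and> (f (?P h h) - f (?P h 0)) - (f (?P 0 h) - f (?P 0 0)) =
      (h - 0) * (?D (?P s h) - ?D (?P s 0))"
  proof (rule MVT2[OF h])
    fix s assume s: "0 \<le> s" "s \<le> h"
    have 1: "((\<lambda>s. f (?P s t)) has_real_derivative ?D (?P s t)) (at s)" if "0 \<le> t" "t \<le> h" for t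
      using line[OF sm, of "x + t *\<^sub>R w" s v] U[OF s that] by (simp add: add_ac)
    show "((\<lambda>s. f (?P s h) - f (?P s 0)) has_real_derivative ?D (?P s h) - ?D (?P s 0)) (at s)"
      using 1[of h] 1[of 0] h by (intro DERIV_diff) auto
  qed
  then obtain s where s: "0 < s" "s < h"
    and e: "(f (?P h h) - f (?P h 0)) - (f (?P 0 h) - f (?P 0 0)) = h * (?D (?P s h) - ?D (?P s 0))"
    by auto
  have "\<exists>t>0. t < h \<and> ?D (?P s h) - ?D (?P s 0) = (h - 0) * frechet_derivative ?D (at (?P s t)) w"
    by (rule MVT2[OF h]) (use s U in \<open>auto intro!: line smooth_on_frechet_derivative sm\<close>)
  then obtain t where "0 < t" "t < h"
    "?D (?P s h) - ?D (?P s 0) = h * frechet_derivative ?D (at (?P s t)) w"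
    by auto
  then show ?thesis
    using s e by (intro exI[of _ s] exI[of _ t]) auto
qed

text \<open>The second difference is symmetric in \<open>v\<close> and \<open>w\<close>, so by
  \<open>second_difference\<close> the two mixed derivatives agree at two points near
  \<open>x\<close>. By continuity their values at \<open>x\<close> then differ by at most any given
  \<open>e\<close>.\<close>

lemma second_derivative_symmetric_real:
  fixes f :: "'a::real_normed_vector \<Rightarrow> real"
  assumes "open U" "x \<in> U" and sm: "smooth_on U f"
  shows "frechet_derivative (\<lambda>y. frechet_derivative f (at y) v) (at x) w =
    frechet_derivative (\<lambda>y. frechet_derivative f (at y) w) (at x) v"
proof -
  let ?D = "\<lambda>v w y. frechet_derivative (\<lambda>y. frechet_derivative f (at y) v) (at y) w"
  have "\<bar>?D v w x - ?D w v x\<bar> \<le> e" if e: "e > 0" for e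
  proof -
    have cont: "continuous (at x) (?D v w)" for v w
      using smooth_on_imp_continuous_on[OF smooth_on_frechet_derivative[OF smooth_on_frechet_derivative[OF sm]]]
        assms by (simp add: continuous_on_eq_continuous_at)
    obtain d0 where d0: "d0 > 0" "ball x d0 \<subseteq> U"
      using assms open_contains_ball by blast
    obtain d1 where d1: "d1 > 0" "\<And>y. dist y x < d1 \<Longrightarrow> dist (?D v w y) (?D v w x) < e / 2"
      using cont[of v w] e unfolding continuous_within_eps_delta by (force dest: spec[of _ "e / 2"])
    obtain d2 where d2: "d2 > 0" "\<And>y. dist y x < d2 \<Longrightarrow> dist (?D w v y) (?D w v x) < e / 2"
      using cont[of w v] e unfolding continuous_within_eps_delta by (force dest: spec[of _ "e / 2"])
    \<comment> \<open>With this \<open>h\<close> the parallelogram on \<open>h\<close> times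
      \<open>v\<close> and \<open>w\<close> stays within \<open>d\<close> of \<open>x\<close>; the
      summand 1 keeps the denominator positive when both vectors vanish.\<close>
    define d where "d = min d0 (min d1 d2)"
    define h where "h = d / (norm v + norm w + 1)"
    have pos1: "0 < norm v + norm w + 1"
      using norm_ge_zero[of v] norm_ge_zero[of w] by linarith
    have h: "0 < h"
      using pos1 d0 d1 d2 by (simp add: h_def d_def)
    have near: "dist (x + s *\<^sub>R v + t *\<^sub>R w) x < d" if "0 \<le> s" "s \<le> h" "0 \<le> t" "t \<le> h" for s t
    proof -
      have "dist (x + s *\<^sub>R v + t *\<^sub>R w) x = norm (s *\<^sub>R v + t *\<^sub>R w)"
        by (simp add: dist_norm add.assoc)
      also have "\<dots> \<le> s * norm v + t * norm w"
        using that by (metis abs_of_nonneg norm_scaleR norm_triangle_ineq)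
      also have "\<dots> \<le> h * norm v + h * norm w"
        using that by (intro add_mono mult_right_mono) auto
      also have "\<dots> < h * (norm v + norm w + 1)"
        using h by (simp add: distrib_left)
      also have "\<dots> = d"
        using pos1 by (simp add: h_def)
      finally show ?thesis .
    qed
    have inU: "x + s *\<^sub>R v + t *\<^sub>R w \<in> U" if "0 \<le> s" "s \<le> h" "0 \<le> t" "t \<le> h" for s t
      using d0(2) near[OF that] by (auto simp: d_def dist_commute)
    obtain s t where st: "0 \<le> s" "s \<le> h" "0 \<le> t" "t \<le> h" and
      e1: "f (x + h *\<^sub>R v + h *\<^sub>R w) - f (x + h *\<^sub>R v) - f (x + h *\<^sub>R w) + f x =
        h * h * ?D v w (x + s *\<^sub>R v + t *\<^sub>R w)"
      using second_difference[OF sm h inU] by blast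
    have inU': "x + s *\<^sub>R w + t *\<^sub>R v \<in> U" if "0 \<le> s" "s \<le> h" "0 \<le> t" "t \<le> h" for s t
      using inU[OF that(3,4,1,2)] by (simp add: add_ac)
    obtain t' s' where st': "0 \<le> s'" "s' \<le> h" "0 \<le> t'" "t' \<le> h" and
      e2: "f (x + h *\<^sub>R w + h *\<^sub>R v) - f (x + h *\<^sub>R w) - f (x + h *\<^sub>R v) + f x =
        h * h * ?D w v (x + t' *\<^sub>R w + s' *\<^sub>R v)"
      using second_difference[OF sm h inU'] by blast
    have "h * h * ?D v w (x + s *\<^sub>R v + t *\<^sub>R w) = h * h * ?D w v (x + s' *\<^sub>R v + t' *\<^sub>R w)"
      using e1 e2 unfolding add.assoc[of x] add.commute[of "_ *\<^sub>R w" "_ *\<^sub>R v"] by linarith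
    then have eq: "?D v w (x + s *\<^sub>R v + t *\<^sub>R w) = ?D w v (x + s' *\<^sub>R v + t' *\<^sub>R w)"
      using h by simp
    have "dist (?D v w (x + s *\<^sub>R v + t *\<^sub>R w)) (?D v w x) < e / 2"
      using near[OF st] by (intro d1) (simp add: d_def)
    moreover have "dist (?D w v (x + s' *\<^sub>R v + t' *\<^sub>R w)) (?D w v x) < e / 2"
      using near[OF st'] by (intro d2) (simp add: d_def)
    ultimately show ?thesis
      unfolding eq dist_real_def by linarith
  qed
  then have "\<bar>?D v w x - ?D w v x\<bar> \<le> 0"
    by (rule field_le_epsilon[of _ 0, simplified])
  then show ?thesis by simp
qed

text \<open>The scalar case applies to each component. Taking components is known to commute with
  the inner derivative on \<open>U\<close> only, hence the local congruence.\<close>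

lemma second_derivative_symmetric:
  fixes f :: "'a::real_normed_vector \<Rightarrow> 'b::euclidean_space"
  assumes "open U" "x \<in> U" and sm: "smooth_on U f"
  shows "frechet_derivative (\<lambda>y. frechet_derivative f (at y) v) (at x) w =
    frechet_derivative (\<lambda>y. frechet_derivative f (at y) w) (at x) v"
proof (rule euclidean_eqI)
  fix b :: 'b
  have diff: "k differentiable (at y)" if "smooth_on U k" "y \<in> U" for k :: "'a \<Rightarrow> 'b" and y
    using smooth_on_has_derivative[OF that] by (auto simp: differentiable_def)
  have comp: "frechet_derivative (\<lambda>y. frechet_derivative f (at y) v) (at x) w \<bullet> b =
      frechet_derivative (\<lambda>y. frechet_derivative (\<lambda>z. f z \<bullet> b) (at y) v) (at x) w" for v w
  proof -
    have "frechet_derivative (\<lambda>y. frechet_derivative f (at y) v) (at x) w \<bullet> b =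
        frechet_derivative (\<lambda>y. frechet_derivative f (at y) v \<bullet> b) (at x) w"
      using diff[OF smooth_on_frechet_derivative[OF sm] assms(2)]
      by (subst frechet_derivative_bounded_linear[OF bounded_linear_inner_left]) auto
    also have "frechet_derivative (\<lambda>y. frechet_derivative f (at y) v \<bullet> b) (at x) =
        frechet_derivative (\<lambda>y. frechet_derivative (\<lambda>z. f z \<bullet> b) (at y) v) (at x)"
    proof (rule frechet_derivative_transform_within_open[OF _ assms(1,2)])
      show "(\<lambda>y. frechet_derivative f (at y) v \<bullet> b) differentiable (at x)"
        using smooth_on_has_derivative[OF smooth_on_bounded_linear[OF assms(1) bounded_linear_inner_left
              smooth_on_frechet_derivative[OF sm]] assms(2)] by (auto simp: differentiable_def)
      show "frechet_derivative f (at y) v \<bullet> b = frechet_derivative (\<lambda>z. f z \<bullet> b) (at y) v" if "y \<in> U" for y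
        using diff[OF sm that] frechet_derivative_bounded_linear[OF bounded_linear_inner_left] by metis
    qed
    finally show ?thesis .
  qed
  show "frechet_derivative (\<lambda>y. frechet_derivative f (at y) v) (at x) w \<bullet> b =
      frechet_derivative (\<lambda>y. frechet_derivative f (at y) w) (at x) v \<bullet> b"
    unfolding comp by (rule second_derivative_symmetric_real[OF assms(1,2)
          smooth_on_bounded_linear[OF assms(1) bounded_linear_inner_left sm]])
qed

text \<open>A product rule for the field \<open>E\<close> pushed forward by \<open>g\<close>: one
  term freezes the direction at \<open>E x\<close>, the other differentiates \<open>E\<close>.
  Smoothness speaks of fixed directions only, so the argument is expanded in a basis.\<close>

lemma has_derivative_frechet_derivative_along:
  fixes g :: "'a::euclidean_space \<Rightarrow> 'b::real_normed_vector"
  assumes "open U" "x \<in> U" "smooth_on U g" "(E has_derivative E') (at x)"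
  shows "((\<lambda>y. frechet_derivative g (at y) (E y)) has_derivative
    (\<lambda>u. frechet_derivative (\<lambda>y. frechet_derivative g (at y) (E x)) (at x) u +
      frechet_derivative g (at x) (E' u))) (at x)"
proof -
  let ?G = "\<lambda>y. frechet_derivative g (at y)"
  have lin: "linear (?G y)" if "y \<in> U" for y
    using smooth_on_has_derivative[OF assms(3) that] by (rule has_derivative_linear)
  note dG = smooth_on_has_derivative[OF smooth_on_frechet_derivative[OF assms(3)] assms(2)]
  have sum: "((\<lambda>y. \<Sum>b\<in>Basis. (c y \<bullet> b) *\<^sub>R ?G y b) has_derivative
      (\<lambda>u. \<Sum>b\<in>Basis. (c x \<bullet> b) *\<^sub>R frechet_derivative (\<lambda>y. ?G y b) (at x) u + (c' u \<bullet> b) *\<^sub>R ?G x b)) (at x)"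
    if "(c has_derivative c') (at x)" for c c'
    by (intro has_derivative_sum has_derivative_scaleR has_derivative_inner_left that dG)
  have eq: "((\<lambda>y. \<Sum>b\<in>Basis. (c y \<bullet> b) *\<^sub>R ?G y b) has_derivative D) (at x) \<longleftrightarrow>
      ((\<lambda>y. ?G y (c y)) has_derivative D) (at x)" for c D
    by (intro iffI; erule has_derivative_transform_within_open[OF _ assms(1,2)])
      (simp_all add: linear_eq_sum_Basis[OF lin, symmetric])
  have frozen: "frechet_derivative (\<lambda>y. ?G y (E x)) (at x) =
      (\<lambda>u. \<Sum>b\<in>Basis. (E x \<bullet> b) *\<^sub>R frechet_derivative (\<lambda>y. ?G y b) (at x) u)"
    using sum[OF has_derivative_const[of "E x"]] unfolding eq
    by (simp add: frechet_derivative_at[symmetric])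
  show ?thesis
    using sum[OF assms(4)] unfolding eq
    by (simp add: frozen sum.distrib linear_eq_sum_Basis[OF lin[OF assms(2)], symmetric])
qed

section \<open>The Levi form of the canonical system\<close>

fun hessian_apply :: "jet2 \<Rightarrow> jet2 \<Rightarrow> real \<times> real" where
  "hessian_apply (_, r, s, t) ((x, y, _), _) = (r * x + s * y, s * x + t * y)"

fun gradient :: "jet2 \<Rightarrow> real \<times> real" where
  "gradient ((x, y, z, p, q), _) = (p, q)"

fun gradient_vector :: "real \<times> real \<Rightarrow> jet2" where
  "gradient_vector (p, q) = ((0, 0, 0, p, q), 0, 0, 0)"

text \<open>
  The pair of contact forms \<open>(dp - r dx - s dy, dq - s dx - t dy)\<close> and its exterior derivative.
\<close>

definition theta :: "jet2 \<Rightarrow> jet2 \<Rightarrow> real \<times> real" where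
  "theta \<tau> v = gradient v - hessian_apply \<tau> v"

definition levi :: "jet2 \<Rightarrow> jet2 \<Rightarrow> real \<times> real" where
  "levi v w = hessian_apply w v - hessian_apply v w"

text \<open>
  The section of the canonical system whose components \<open>(dx, dy, dr, ds, dt)\<close> are constantly those
  of \<open>v\<close>; the other components of \<open>v\<close> are ignored.
\<close>

fun frame :: "jet2 \<Rightarrow> jet2 \<Rightarrow> jet2" where
  "frame v ((_, _, _, p, q), r, s, t) =
    (case v of ((x', y', _), w) \<Rightarrow> ((x', y', p * x' + q * y', r * x' + s * y', s * x' + t * y'), w))"

fun frame_derivative :: "jet2 \<Rightarrow> jet2 \<Rightarrow> jet2" where
  "frame_derivative v ((_, _, _, p, q), r, s, t) =
    (case v of ((x', y', _), w) \<Rightarrow> ((0, 0, p * x' + q * y', r * x' + s * y', s * x' + t * y'), 0))"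

text \<open>The frame field of a canonical vector passes through that vector, so every canonical
  vector extends to a section of the system.\<close>

lemma canonical_system_iff_frame: "v \<in> canonical_system \<sigma> \<longleftrightarrow> frame v \<sigma> = v"
proof -
  obtain x y z p q r s t where "\<sigma> = ((x, y, z, p, q), r, s, t)"
    by (metis prod.collapse)
  moreover obtain x' y' z' p' q' r' s' t' where "v = ((x', y', z', p', q'), r', s', t')"
    by (metis prod.collapse)
  ultimately show ?thesis by auto
qed

lemma frame_in_canonical_system: "frame v \<sigma> \<in> canonical_system \<sigma>"
proof -
  obtain x y z p q r s t where "\<sigma> = ((x, y, z, p, q), r, s, t)"
    by (metis prod.collapse)
  moreover obtain x' y' z' p' q' r' s' t' where "v = ((x', y', z', p', q'), r', s', t')"
    by (metis prod.collapse)
  ultimately show ?thesis by auto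
qed

lemma theta_canonical_system: "v \<in> canonical_system \<sigma> \<Longrightarrow> theta \<sigma> v = 0"
  by (cases \<sigma> rule: canonical_system.cases)
    (auto simp: theta_def zero_prod_def split_paired_all)

lemma bounded_bilinear_hessian_apply: "bounded_bilinear hessian_apply"
  by (simp add: bilinear_conv_bounded_bilinear[symmetric] bilinear_def linear_iff split_paired_all
      algebra_simps)

lemma bounded_linear_gradient: "bounded_linear gradient"
  by (simp add: linear_conv_bounded_linear[symmetric] linear_iff split_paired_all)

lemma bounded_linear_gradient_vector: "bounded_linear gradient_vector"
  by (simp add: linear_conv_bounded_linear[symmetric] linear_iff split_paired_all zero_prod_def)

lemma linear_theta: "linear (theta \<tau>)"
  using bounded_linear.linear[OF bounded_linear_gradient]
    bounded_linear.linear[OF bounded_bilinear.bounded_linear_right[OF bounded_bilinear_hessian_apply]]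
  unfolding theta_def by (rule linear_compose_sub)

lemma bounded_linear_frame_derivative: "bounded_linear (frame_derivative v)"
proof -
  obtain x y z w where "v = ((x, y, z), w)"
    by (metis prod.collapse)
  then show ?thesis
    by (simp add: linear_conv_bounded_linear[symmetric] linear_iff split_paired_all zero_prod_def
        algebra_simps)
qed

lemma has_derivative_frame: "(frame v has_derivative frame_derivative v) (at \<sigma>)"
proof -
  \<comment> \<open>The frame field is affine in the point, with linear part
    \<open>frame_derivative v\<close>.\<close>
  have "frame v = (\<lambda>\<sigma>. frame v 0 + frame_derivative v \<sigma>)"
    by (cases v) (auto simp: fun_eq_iff zero_prod_def)
  moreover have "((\<lambda>\<sigma>. frame v 0 + frame_derivative v \<sigma>) has_derivative frame_derivative v) (at \<sigma>)"
    using has_derivative_add[OF has_derivative_const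
        bounded_linear_imp_has_derivative[OF bounded_linear_frame_derivative]] by simp
  ultimately show ?thesis by simp
qed

text \<open>Up to sign this is the bracket of the two frame fields. Its \<open>dz\<close> component
  cancels because the \<open>dp\<close>, \<open>dq\<close> components of both vectors come from the
  same symmetric matrix \<open>(r, s, t)\<close> at \<sigma>; what is left is the Levi form.\<close>

lemma frame_bracket:
  assumes "v \<in> canonical_system \<sigma>" "w \<in> canonical_system \<sigma>"
  shows "frame_derivative v w - frame_derivative w v = gradient_vector (levi v w)"
proof -
  obtain x y z p q r s t where "\<sigma> = ((x, y, z, p, q), r, s, t)"
    by (metis prod.collapse)
  moreover obtain x' y' z' p' q' r' s' t' where "v = ((x', y', z', p', q'), r', s', t')"
    by (metis prod.collapse)
  moreover obtain x' y' z' p' q' r' s' t' where "w = ((x', y', z', p', q'), r', s', t')"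
    by (metis prod.collapse)
  ultimately show ?thesis
    using assms by (auto simp: levi_def zero_prod_def algebra_simps)
qed

text \<open>
  Differentiate \<open>theta (g \<sigma>) (dg (frame v \<sigma>)) = 0\<close> along \<open>w\<close> and antisymmetrize in \<open>v\<close>, \<open>w\<close>: the second
  derivatives of \<open>g\<close> cancel, leaving the bracket of the two frame fields.
\<close>

lemma levi_frechet_derivative:
  assumes V: "open V" and g: "smooth_on V g"
    and C: "\<And>\<sigma>. \<sigma> \<in> V \<Longrightarrow>
      frechet_derivative g (at \<sigma>) ` canonical_system \<sigma> \<subseteq> canonical_system (g \<sigma>)"
    and \<sigma>: "\<sigma> \<in> V" and v: "v \<in> canonical_system \<sigma>" and w: "w \<in> canonical_system \<sigma>"
  shows "levi (frechet_derivative g (at \<sigma>) v) (frechet_derivative g (at \<sigma>) w) =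
    theta (g \<sigma>) (frechet_derivative g (at \<sigma>) (gradient_vector (levi v w)))"
proof -
  let ?G = "\<lambda>\<sigma>. frechet_derivative g (at \<sigma>)"
  let ?H = "\<lambda>v w. frechet_derivative (\<lambda>\<tau>. ?G \<tau> v) (at \<sigma>) w"
  \<comment> \<open>For canonical \<open>v\<close> this is the derivative along \<open>w\<close> of
    the pushed-forward frame field of \<open>v\<close>.\<close>
  let ?K = "\<lambda>v w. ?H v w + ?G \<sigma> (frame_derivative v w)"
  note dg = smooth_on_has_derivative[OF g \<sigma>]
  have deriv: "hessian_apply (?G \<sigma> w) (?G \<sigma> v) = theta (g \<sigma>) (?K v w)"
    if v: "v \<in> canonical_system \<sigma>" for v w
  proof -
    have fr: "frame v \<sigma> = v"
      using v canonical_system_iff_frame by blast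
    have K: "((\<lambda>\<tau>. ?G \<tau> (frame v \<tau>)) has_derivative ?K v) (at \<sigma>)"
      using has_derivative_frechet_derivative_along[OF V \<sigma> g has_derivative_frame[of v]]
      by (simp add: fr)
    have "((\<lambda>\<tau>. theta (g \<tau>) (?G \<tau> (frame v \<tau>))) has_derivative
        (\<lambda>u. gradient (?K v u) -
          (hessian_apply (g \<sigma>) (?K v u) + hessian_apply (?G \<sigma> u) (?G \<sigma> (frame v \<sigma>))))) (at \<sigma>)"
      unfolding theta_def
      by (intro has_derivative_diff bounded_linear.has_derivative[OF bounded_linear_gradient K]
          bounded_bilinear.FDERIV[OF bounded_bilinear_hessian_apply dg K])
    \<comment> \<open>The frame field is canonical throughout \<open>V\<close> and \<open>g\<close>
      preserves the system, so the function just differentiated is zero on \<open>V\<close>.\<close>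
    moreover have "theta (g \<tau>) (?G \<tau> (frame v \<tau>)) = 0" if "\<tau> \<in> V" for \<tau>
      using theta_canonical_system C[OF that] frame_in_canonical_system by blast
    ultimately have "((\<lambda>\<tau>. 0) has_derivative
        (\<lambda>u. gradient (?K v u) -
          (hessian_apply (g \<sigma>) (?K v u) + hessian_apply (?G \<sigma> u) (?G \<sigma> (frame v \<sigma>))))) (at \<sigma>)"
      by (rule has_derivative_transform_within_open[OF _ V \<sigma>])
    from has_derivative_unique[OF this has_derivative_const]
    have "gradient (?K v w) - (hessian_apply (g \<sigma>) (?K v w) + hessian_apply (?G \<sigma> w) (?G \<sigma> v)) = 0"
      unfolding fr by (rule fun_cong)
    then show ?thesis
      by (simp add: theta_def algebra_simps)
  qed
  have "?H v w = ?H w v"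
    using second_derivative_symmetric[OF V \<sigma> g] .
  then have "?K v w - ?K w v = ?G \<sigma> (frame_derivative v w - frame_derivative w v)"
    by (simp add: linear_diff[OF has_derivative_linear[OF dg]])
  then have "theta (g \<sigma>) (?K v w) - theta (g \<sigma>) (?K w v) = theta (g \<sigma>) (?G \<sigma> (gradient_vector (levi v w)))"
    unfolding linear_diff[OF linear_theta, symmetric] frame_bracket[OF v w] by simp
  then show ?thesis
    unfolding deriv[OF v, symmetric] deriv[OF w, symmetric] by (simp add: levi_def)
qed

section \<open>The cone of rank-one vertical directions\<close>

definition rank_one_directions :: "jet2 set" where
  "rank_one_directions = {(0, r, s, t) | r s t. r * t = s\<^sup>2}"

definition det2 :: "real \<times> real \<Rightarrow> real \<times> real \<Rightarrow> real" where
  "det2 u v = fst u * snd v - snd u * fst v"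

text \<open>A linear map of the plane multiplies \<open>det2\<close> by its determinant.\<close>

lemma det2_linear:
  assumes "linear M" "det2 u v = 0"
  shows "det2 (M u) (M v) = 0"
proof -
  have M: "M w = fst w *\<^sub>R M (1, 0) + snd w *\<^sub>R M (0, 1)" for w
    using linear_add[OF assms(1), of "fst w *\<^sub>R (1, 0)" "snd w *\<^sub>R (0, 1)"]
    by (simp add: linear_scale[OF assms(1), symmetric])
  have "det2 (M u) (M v) = det2 u v * det2 (M (1, 0)) (M (0, 1))"
    by (subst M[of u], subst M[of v]) (simp add: det2_def algebra_simps)
  then show ?thesis
    using assms(2) by simp
qed

text \<open>The Levi form alone determines the cone, which is why contact maps preserve it.\<close>

lemma rank_one_directions_iff:
  assumes "v \<in> canonical_system \<sigma>"
  shows "v \<in> rank_one_directions \<longleftrightarrow>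
    (\<forall>w\<in>canonical_system \<sigma>. \<forall>w'\<in>canonical_system \<sigma>. det2 (levi v w) (levi v w') = 0)"
  (is "_ \<longleftrightarrow> ?rhs")
proof
  assume "v \<in> rank_one_directions"
  then obtain r s t where v: "v = (0, r, s, t)" and rt: "r * t = s\<^sup>2"
    by (auto simp: rank_one_directions_def)
  \<comment> \<open>For vertical \<open>v\<close> the Levi form is minus the matrix
    \<open>(r, s, t)\<close> applied to the \<open>(x, y)\<close> part of the other vector, so the
    determinant of that matrix splits off.\<close>
  have "det2 (levi v w) (levi v w') = 0" for w w'
  proof -
    obtain x y z l x' y' z' l' where w: "w = ((x, y, z), l)" "w' = ((x', y', z'), l')"
      by (metis prod.collapse)
    have "det2 (levi v w) (levi v w') = (r * t - s\<^sup>2) * (x * y' - x' * y)"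
      unfolding v w by (cases l; cases l')
        (simp add: levi_def det2_def zero_prod_def algebra_simps power2_eq_square)
    then show ?thesis
      using rt by simp
  qed
  then show ?rhs by blast
next
  assume R: ?rhs
  obtain x y z p q r s t where v: "v = ((x, y, z, p, q), r, s, t)"
    by (metis prod.collapse)
  obtain X Y Z P Q R S T where \<sigma>: "\<sigma> = ((X, Y, Z, P, Q), R, S, T)"
    by (metis prod.collapse)
  have "((0, 0, 0, 0, 0), a, b, c) \<in> canonical_system \<sigma>" for a b c
    by (simp add: \<sigma>)
  \<comment> \<open>On these vertical test vectors the two determinants are the squares of
    \<open>x\<close> and \<open>y\<close>.\<close>
  then have "det2 (levi v ((0, 0, 0, 0, 0), 1, 0, 0)) (levi v ((0, 0, 0, 0, 0), 0, 1, 0)) = 0"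
    and "det2 (levi v ((0, 0, 0, 0, 0), 0, 1, 0)) (levi v ((0, 0, 0, 0, 0), 0, 0, 1)) = 0"
    using R by blast+
  then have xy: "x = 0" "y = 0"
    by (simp_all add: v levi_def det2_def)
  then have z: "z = 0" "p = 0" "q = 0"
    using assms by (simp_all add: v \<sigma>)
  \<comment> \<open>Once \<open>v\<close> is vertical, the lifts of the two coordinate directions
    test the determinant of its matrix.\<close>
  have "((1, 0, P, R, S), 0, 0, 0) \<in> canonical_system \<sigma>" "((0, 1, Q, S, T), 0, 0, 0) \<in> canonical_system \<sigma>"
    by (simp_all add: \<sigma>)
  then have "det2 (levi v ((1, 0, P, R, S), 0, 0, 0)) (levi v ((0, 1, Q, S, T), 0, 0, 0)) = 0"
    using R by blast
  then have "r * t = s\<^sup>2"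
    by (simp add: v levi_def det2_def power2_eq_square)
  then show "v \<in> rank_one_directions"
    by (simp add: rank_one_directions_def v xy z zero_prod_def)
qed

lemma rank_one_directions_subset: "rank_one_directions \<subseteq> canonical_system \<sigma>"
proof -
  obtain X Y Z P Q R S T where "\<sigma> = ((X, Y, Z, P, Q), R, S, T)"
    by (metis prod.collapse)
  then show ?thesis
    by (auto simp: rank_one_directions_def zero_prod_def)
qed

text \<open>By \<open>levi_frechet_derivative\<close> the Levi form of the images is that of the
  originals followed by one linear map, which keeps degeneracy by \<open>det2_linear\<close>.
  Equality of the canonical systems makes every test vector in the target an image.\<close>

lemma frechet_derivative_rank_one_directions:
  assumes V: "open V" and g: "smooth_on V g"
    and C: "\<And>\<sigma>. \<sigma> \<in> V \<Longrightarrow>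
      frechet_derivative g (at \<sigma>) ` canonical_system \<sigma> = canonical_system (g \<sigma>)"
    and \<sigma>: "\<sigma> \<in> V" and v: "v \<in> rank_one_directions"
  shows "frechet_derivative g (at \<sigma>) v \<in> rank_one_directions"
proof -
  let ?G = "frechet_derivative g (at \<sigma>)"
  let ?M = "\<lambda>u. theta (g \<sigma>) (?G (gradient_vector u))"
  have M: "linear ?M"
    using linear_compose[OF bounded_linear.linear[OF bounded_linear_gradient_vector]
        linear_compose[OF has_derivative_linear[OF smooth_on_has_derivative[OF g \<sigma>]] linear_theta]]
    by (simp add: o_def)
  have vC: "v \<in> canonical_system \<sigma>"
    using v rank_one_directions_subset by blast
  have "det2 (levi (?G v) u) (levi (?G v) u') = 0"
    if u: "u \<in> canonical_system (g \<sigma>)" "u' \<in> canonical_system (g \<sigma>)" for u u'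
  proof -
    obtain w w' where w: "w \<in> canonical_system \<sigma>" "w' \<in> canonical_system \<sigma>" "u = ?G w" "u' = ?G w'"
      using u C[OF \<sigma>] by blast
    have "levi (?G v) (?G w) = ?M (levi v w)" if "w \<in> canonical_system \<sigma>" for w
      using C that by (intro levi_frechet_derivative[OF V g _ \<sigma> vC]) auto
    then show ?thesis
      using w det2_linear[OF M] v rank_one_directions_iff[OF vC] by simp
  qed
  moreover have "?G v \<in> canonical_system (g \<sigma>)"
    using vC C[OF \<sigma>] by blast
  ultimately show ?thesis
    using rank_one_directions_iff by blast
qed

section \<open>Hyperbolicity\<close>

lemma linear_vertical:
  assumes "linear L"
  shows "L (0, r, s, t) = r *\<^sub>R L (0, 1, 0, 0) + s *\<^sub>R L (0, 0, 1, 0) + t *\<^sub>R L (0, 0, 0, 1)"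
  by (simp add: linear_add[OF assms, symmetric] linear_scale[OF assms, symmetric])

lemma vertical_eq_0_iff: "(0, r, s, t) = (0 :: jet2) \<longleftrightarrow> r = 0 \<and> s = 0 \<and> t = 0"
  by (simp add: prod_eq_iff)

text \<open>The cone is not a subspace, but three of its elements form a basis of the vertical
  space.\<close>

lemma linear_vertical_if_rank_one_directions:
  assumes "linear L" "\<And>v. v \<in> rank_one_directions \<Longrightarrow> L v \<in> rank_one_directions" "v \<in> vertical"
  shows "L v \<in> vertical"
proof -
  obtain r s t where v: "v = (0, r, s, t)"
    using assms(3) by (cases v) (auto simp: vertical_def)
  have cone: "(0, 1, 0, 0) \<in> rank_one_directions" "(0, 0, 0, 1) \<in> rank_one_directions"
    "(0, 1, 1, 1) \<in> rank_one_directions"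
    by (auto simp: rank_one_directions_def)
  have "v = (r - s) *\<^sub>R (0, 1, 0, 0) + (t - s) *\<^sub>R (0, 0, 0, 1) + s *\<^sub>R (0, 1, 1, 1)"
    by (simp add: v)
  then have "L v = (r - s) *\<^sub>R L (0, 1, 0, 0) + (t - s) *\<^sub>R L (0, 0, 0, 1) + s *\<^sub>R L (0, 1, 1, 1)"
    using assms(1) by (simp only: linear_add linear_scale)
  then show ?thesis
    using cone[THEN assms(2)] by (auto simp: rank_one_directions_def vertical_def)
qed

text \<open>On the cone vector \<open>(m^2, m, 1)\<close> the functional is the quadratic
  \<open>a m^2 + b m + c\<close>. Hyperbolicity is positivity of its discriminant, and distinct
  roots give independent vectors.\<close>

lemma hyperbolic_imp_isotropic_pair:
  fixes L :: "jet2 \<Rightarrow> real"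
  assumes "linear L" "L (0, 1, 0, 0) * L (0, 0, 0, 1) - 1/4 * (L (0, 0, 1, 0))\<^sup>2 < 0"
  obtains u u' where "u \<in> rank_one_directions" "u' \<in> rank_one_directions" "L u = 0" "L u' = 0"
    "u \<noteq> 0" "\<forall>c. u' \<noteq> c *\<^sub>R u"
proof -
  define a b c where abc: "a = L (0, 1, 0, 0)" "b = L (0, 0, 1, 0)" "c = L (0, 0, 0, 1)"
  have L: "L (0, r, s, t) = a * r + b * s + c * t" for r s t
    using linear_vertical[OF assms(1), of r s t] by (simp add: abc algebra_simps)
  have disc: "b\<^sup>2 - 4 * a * c > 0"
    using assms(2) by (simp add: abc)
  have cone: "(0, m\<^sup>2, m, 1) \<in> rank_one_directions" "(0, 1, 0, 0) \<in> rank_one_directions" for m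
    by (auto simp: rank_one_directions_def)
  show thesis
  proof (cases "a = 0")
    \<comment> \<open>One root is now at infinity, where the cone vector is
      \<open>(1, 0, 0)\<close>.\<close>
    case True
    then have "b \<noteq> 0" using disc by auto
    then show thesis
      using True cone(1)[of "- c / b"] cone(2)
      by (intro that[of "(0, 1, 0, 0)" "(0, (- c / b)\<^sup>2, - c / b, 1)"]) (auto simp: L vertical_eq_0_iff)
  next
    case False
    define d where "d = sqrt (b\<^sup>2 - 4 * a * c)"
    have d: "d > 0" "d\<^sup>2 = b\<^sup>2 - 4 * a * c"
      using disc by (simp_all add: d_def)
    have root: "a * m\<^sup>2 + b * m + c = 0" if "m = (e - b) / (2 * a)" "e\<^sup>2 = d\<^sup>2" for m e
    proof -
      have "e = 2 * a * m + b"
        using that(1) False by (simp add: field_simps)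
      then have "4 * a * (a * m\<^sup>2 + b * m + c) = 0"
        using that(2) d(2) by (simp add: power2_eq_square algebra_simps)
      then show ?thesis using False by simp
    qed
    have "(d - b) / (2 * a) \<noteq> (- d - b) / (2 * a)"
      using d False by simp
    then show thesis
      using cone(1) root[OF refl, of d] root[OF refl, of "- d"]
      by (intro that[of "(0, ((d - b) / (2 * a))\<^sup>2, (d - b) / (2 * a), 1)"
            "(0, ((- d - b) / (2 * a))\<^sup>2, (- d - b) / (2 * a), 1)"])
        (auto simp: L vertical_eq_0_iff)
  qed
qed

text \<open>The form \<open>r t - s^2\<close> has signature (1, 2), so two independent null vectors
  are not orthogonal. As they span the kernel of \<open>L\<close> on the vertical space, where
  \<open>v\<close> shows \<open>L\<close> to be non-zero, the discriminant is positive.\<close>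

lemma isotropic_pair_imp_hyperbolic:
  fixes L :: "jet2 \<Rightarrow> real"
  assumes "linear L" "u \<in> rank_one_directions" "u' \<in> rank_one_directions" "L u = 0" "L u' = 0"
    "u \<noteq> 0" "\<forall>c. u' \<noteq> c *\<^sub>R u" "v \<in> vertical" "L v \<noteq> 0"
  shows "L (0, 1, 0, 0) * L (0, 0, 0, 1) - 1/4 * (L (0, 0, 1, 0))\<^sup>2 < 0"
proof -
  define a b c where abc: "a = L (0, 1, 0, 0)" "b = L (0, 0, 1, 0)" "c = L (0, 0, 0, 1)"
  have L: "L (0, r, s, t) = a * r + b * s + c * t" for r s t
    using linear_vertical[OF assms(1), of r s t] by (simp add: abc algebra_simps)
  obtain r s t r' s' t' where u: "u = (0, r, s, t)" "u' = (0, r', s', t')"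
    and q: "r * t = s\<^sup>2" "r' * t' = s'\<^sup>2"
    using assms(2,3) by (auto simp: rank_one_directions_def)
  have l: "a * r + b * s + c * t = 0" "a * r' + b * s' + c * t' = 0"
    using assms(4,5) by (simp_all add: u L)
  \<comment> \<open>\<open>P\<close> is the polarization of \<open>r t - s^2\<close> at the two
    vectors.\<close>
  define P where "P = r * t' + r' * t - 2 * s * s'"
  have "P \<noteq> 0"
  proof
    assume P: "P = 0"
    then have "(r * t' - r' * t)\<^sup>2 = 4 * (s * s')\<^sup>2 - 4 * (r * t) * (r' * t')"
      unfolding P_def by algebra
    then have 2: "r * t' = r' * t"
      by (simp add: q power_mult_distrib)
    then have "s * s' = r * t'"
      using P by (simp add: P_def)
    then have "(s * t' - s' * t)\<^sup>2 = 0" "(r * s' - r' * s)\<^sup>2 = 0"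
      using q 2 by algebra+
    then have 13: "s * t' = s' * t" "r * s' = r' * s"
      by simp_all
    consider "r \<noteq> 0" | "t \<noteq> 0"
      using assms(6) q(1) unfolding u vertical_eq_0_iff by (metis mult_zero_left zero_eq_power2)
    then show False
    proof cases
      case 1
      then have "u' = (r' / r) *\<^sub>R u"
        using 13 2 by (simp add: u field_simps)
      then show False using assms(7) by blast
    next
      case 2
      then have "u' = (t' / t) *\<^sub>R u"
        using 13 \<open>r * t' = r' * t\<close> by (simp add: u field_simps)
      then show False using assms(7) by blast
    qed
  qed
  text \<open>\<open>(a, b, c)\<close> is proportional to the cross product of \<open>(r, s, t)\<close> and \<open>(r', s', t')\<close>, whose
    discriminant is \<open>P\<^sup>2\<close>.\<close>
  have "(b\<^sup>2 - 4 * a * c) * (s * t' - s' * t)\<^sup>2 = a\<^sup>2 * P\<^sup>2"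
    "(b\<^sup>2 - 4 * a * c) * (t * r' - t' * r)\<^sup>2 = b\<^sup>2 * P\<^sup>2"
    "(b\<^sup>2 - 4 * a * c) * (r * s' - r' * s)\<^sup>2 = c\<^sup>2 * P\<^sup>2"
    using l q unfolding P_def by algebra+
  moreover obtain r0 s0 t0 where "v = (0, r0, s0, t0)"
    using assms(8) by (cases v) (auto simp: vertical_def)
  then have "a \<noteq> 0 \<or> b \<noteq> 0 \<or> c \<noteq> 0"
    using assms(9) by (auto simp: L)
  \<comment> \<open>Whichever coefficient is non-zero, its identity has a positive right side, so
    the discriminant times a square is positive.\<close>
  moreover have "0 < D" if "D * m\<^sup>2 = l\<^sup>2 * P\<^sup>2" "l \<noteq> 0" for D m l
  proof -
    have "0 < D * m\<^sup>2"
      using that \<open>P \<noteq> 0\<close> by simp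
    then show ?thesis
      by (simp add: zero_less_mult_iff)
  qed
  ultimately have "0 < b\<^sup>2 - 4 * a * c"
    by blast
  then show ?thesis by (simp add: abc)
qed

lemma is_hyperbolicE:
  assumes "is_hyperbolic S" "\<sigma> \<in> S"
  obtains W F where "\<sigma> \<in> W" "local_equation W F S"
    "\<forall>\<tau>\<in>S \<inter> W. F_r F \<tau> * F_t F \<tau> - 1/4 * (F_s F \<tau>)\<^sup>2 < 0"
proof -
  show thesis
    using assms(1)[unfolded is_hyperbolic_def, rule_format, OF assms(2)]
    by (elim exE conjE) (rule that)
qed

lemma hyperbolic_imp_nonzero_vertical:
  assumes "F_r F \<tau> * F_t F \<tau> - 1/4 * (F_s F \<tau>)\<^sup>2 < 0"
  obtains v where "v \<in> vertical" "frechet_derivative F (at \<tau>) v \<noteq> 0"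
proof -
  have "F_r F \<tau> \<noteq> 0 \<or> F_s F \<tau> \<noteq> 0"
    using assms by auto
  then show thesis
    using that[of "(0, 1, 0, 0)"] that[of "(0, 0, 1, 0)"]
    by (auto simp: F_r_def F_s_def vertical_def)
qed

text \<open>Some vertical vector lies outside the kernel of the differential; projecting along it
  onto the kernel gives both transversality and surjectivity.\<close>

lemma is_pde_if_is_hyperbolic:
  assumes "is_hyperbolic S"
  shows "is_pde S"
  unfolding is_pde_def
proof
  fix \<sigma> assume \<sigma>: "\<sigma> \<in> S"
  obtain W F where W: "\<sigma> \<in> W" and loc: "local_equation W F S"
    and hyp: "\<forall>\<tau>\<in>S \<inter> W. F_r F \<tau> * F_t F \<tau> - 1/4 * (F_s F \<tau>)\<^sup>2 < 0"
    using is_hyperbolicE[OF assms \<sigma>] .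
  have "{u + v | u v. u \<in> equation_tangent F \<tau> \<and> v \<in> vertical} = UNIV \<and>
      fst ` equation_tangent F \<tau> = UNIV" if \<tau>: "\<tau> \<in> S \<inter> W" for \<tau>
  proof -
    let ?L = "frechet_derivative F (at \<tau>)"
    have L: "linear ?L"
      using loc \<tau> by (auto simp: local_equation_def intro: has_derivative_linear smooth_on_has_derivative)
    obtain n where n: "n \<in> vertical" "?L n \<noteq> 0"
      using hyperbolic_imp_nonzero_vertical[OF bspec[OF hyp \<tau>]] .
    define pr where "pr w = w - (?L w / ?L n) *\<^sub>R n" for w
    have pr: "pr w \<in> equation_tangent F \<tau>" for w
      using n by (simp add: pr_def equation_tangent_def linear_diff[OF L] linear_scale[OF L])
    have "w \<in> {u + v | u v. u \<in> equation_tangent F \<tau> \<and> v \<in> vertical}" for w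
    proof (rule CollectI, intro exI conjI)
      show "w = pr w + (?L w / ?L n) *\<^sub>R n"
        by (simp add: pr_def)
      show "(?L w / ?L n) *\<^sub>R n \<in> vertical"
        using n(1) by (simp add: vertical_def)
    qed (rule pr)
    moreover have "fst (pr (w, 0)) = w" for w
      using n by (simp add: pr_def vertical_def)
    ultimately show ?thesis
      using pr by (metis (no_types, lifting) UNIV_eq_I image_eqI)
  qed
  then show "\<exists>W F. \<sigma> \<in> W \<and> local_equation W F S \<and>
     (\<forall>\<tau>\<in>S \<inter> W. {u + v | u v. u \<in> equation_tangent F \<tau> \<and> v \<in> vertical} = UNIV \<and>
        fst ` equation_tangent F \<tau> = UNIV)"
    using W loc by blast
qed

section \<open>Inverse contact maps and pullback of hyperbolic equations\<close>

lemma contact_transformation_inverse: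
  assumes "contact_transformation U V \<phi>"
  obtains g where "homeomorphism U V \<phi> g" "smooth_on V g"
    "\<And>\<sigma> v. \<sigma> \<in> V \<Longrightarrow> frechet_derivative g (at \<sigma>) (frechet_derivative \<phi> (at (g \<sigma>)) v) = v"
    "\<And>\<sigma>. \<sigma> \<in> V \<Longrightarrow>
      frechet_derivative g (at \<sigma>) ` canonical_system \<sigma> = canonical_system (g \<sigma>)"
proof -
  obtain g where UV: "open U" "open V" and hom: "homeomorphism U V \<phi> g"
    and \<phi>: "smooth_on U \<phi>" and g: "smooth_on V g"
    and C: "\<And>\<sigma>. \<sigma> \<in> U \<Longrightarrow>
      frechet_derivative \<phi> (at \<sigma>) ` canonical_system \<sigma> = canonical_system (\<phi> \<sigma>)"
    using assms by (auto simp: contact_transformation_def diffeomorphism_between_def)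
  have mem: "g \<sigma> \<in> U" "\<phi> (g \<sigma>) = \<sigma>" if "\<sigma> \<in> V" for \<sigma>
    using hom that by (auto simp: homeomorphism_def)
  have g\<phi>: "frechet_derivative g (at \<sigma>) (frechet_derivative \<phi> (at (g \<sigma>)) v) = v"
    if \<sigma>: "\<sigma> \<in> V" for \<sigma> v
  proof -
    have "((\<lambda>\<tau>. g (\<phi> \<tau>)) has_derivative
        (\<lambda>v. frechet_derivative g (at \<sigma>) (frechet_derivative \<phi> (at (g \<sigma>)) v))) (at (g \<sigma>))"
      using diff_chain_at[OF smooth_on_has_derivative[OF \<phi> mem(1)[OF \<sigma>]],
          of g "frechet_derivative g (at \<sigma>)"] smooth_on_has_derivative[OF g \<sigma>]
      by (simp add: o_def mem(2)[OF \<sigma>])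
    \<comment> \<open>The composite is the identity near \<open>g \<sigma>\<close>, so its
      derivative is the identity by uniqueness.\<close>
    then have "((\<lambda>\<tau>. \<tau>) has_derivative
        (\<lambda>v. frechet_derivative g (at \<sigma>) (frechet_derivative \<phi> (at (g \<sigma>)) v))) (at (g \<sigma>))"
      by (rule has_derivative_transform_within_open[OF _ UV(1) mem(1)[OF \<sigma>]])
        (use hom in \<open>auto simp: homeomorphism_def\<close>)
    from has_derivative_unique[OF this has_derivative_ident] show ?thesis
      by (rule fun_cong)
  qed
  have "frechet_derivative g (at \<sigma>) ` canonical_system \<sigma> = canonical_system (g \<sigma>)" if "\<sigma> \<in> V" for \<sigma>
    using C[OF mem(1)[OF that]] mem(2)[OF that] g\<phi>[OF that]
    by (metis (no_types, lifting) image_image image_ident image_cong)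
  then show thesis
    using that hom g g\<phi> by blast
qed

text \<open>As a preimage under the inverse, the image set is described by equations composed with
  \<open>g\<close>.\<close>

lemma contact_image_eq_preimage:
  "homeomorphism U V \<phi> g \<Longrightarrow> \<phi> ` (S \<inter> U) = {\<sigma> \<in> V. g \<sigma> \<in> S}"
  by (fastforce simp: homeomorphism_def)

lemma frechet_derivative_compose_at:
  assumes "smooth_on V g" "\<sigma> \<in> V" "smooth_on W f" "g \<sigma> \<in> W"
  shows "frechet_derivative (\<lambda>\<tau>. f (g \<tau>)) (at \<sigma>) v =
    frechet_derivative f (at (g \<sigma>)) (frechet_derivative g (at \<sigma>) v)"
  using fun_cong[OF frechet_derivative_at[OF diff_chain_at[OF smooth_on_has_derivative[OF assms(1,2)]
      smooth_on_has_derivative[OF assms(3,4)]]], of v]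
  unfolding o_def by (rule sym)

text \<open>The differential of the composite stays non-zero because that of \<open>g\<close> is
  surjective.\<close>

lemma local_equation_pullback:
  assumes "open V" "smooth_on V g" "local_equation W F S"
    and surj: "\<And>\<sigma>. \<sigma> \<in> V \<Longrightarrow> surj (frechet_derivative g (at \<sigma>))"
  shows "local_equation (V \<inter> g -` W) (\<lambda>\<sigma>. F (g \<sigma>)) {\<sigma> \<in> V. g \<sigma> \<in> S}"
proof -
  have W: "open W" and F: "smooth_on W F" and SW: "S \<inter> W = {\<sigma>\<in>W. F \<sigma> = 0}"
    and nz: "\<And>\<sigma>. \<sigma> \<in> S \<inter> W \<Longrightarrow> \<exists>v. frechet_derivative F (at \<sigma>) v \<noteq> 0"
    using assms(3) by (auto simp: local_equation_def)
  have op: "open (V \<inter> g -` W)"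
    using continuous_open_preimage[OF smooth_on_imp_continuous_on[OF assms(2)] assms(1) W] .
  have "smooth_on (V \<inter> g -` W) (\<lambda>\<sigma>. F (g \<sigma>))"
    using assms(2) by (intro smooth_on_compose[OF op _ F]) (auto intro: smooth_on_subset)
  moreover have "\<exists>v. frechet_derivative (\<lambda>\<sigma>. F (g \<sigma>)) (at \<sigma>) v \<noteq> 0"
    if \<sigma>: "\<sigma> \<in> V" "g \<sigma> \<in> S" "g \<sigma> \<in> W" for \<sigma>
  proof -
    obtain u where "frechet_derivative F (at (g \<sigma>)) u \<noteq> 0"
      using nz[of "g \<sigma>"] \<sigma> by blast
    moreover obtain v where "u = frechet_derivative g (at \<sigma>) v"
      using surj[OF \<sigma>(1)] by (rule surjE)
    ultimately show ?thesis
      using frechet_derivative_compose_at[OF assms(2) \<sigma>(1) F \<sigma>(3), of v] by (intro exI[of _ v]) simp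
  qed
  ultimately show ?thesis
    unfolding local_equation_def using op SW by (intro conjI) auto
qed

text \<open>\<open>B \<sigma>\<close> is a right inverse of the differential of \<open>g\<close>
  that preserves the cone. It lifts the isotropic pair of \<open>F\<close>, and a vertical vector
  not killed by \<open>F\<close>, to such vectors for the composite.\<close>

lemma is_hyperbolic_pullback:
  assumes V: "open V" and g: "smooth_on V g"
    and g\<phi>: "\<And>\<sigma> v. \<sigma> \<in> V \<Longrightarrow> frechet_derivative g (at \<sigma>) (B \<sigma> v) = v"
    and linB: "\<And>\<sigma>. \<sigma> \<in> V \<Longrightarrow> linear (B \<sigma>)"
    and coneB: "\<And>\<sigma> v. \<sigma> \<in> V \<Longrightarrow> v \<in> rank_one_directions \<Longrightarrow> B \<sigma> v \<in> rank_one_directions"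
    and S: "is_hyperbolic S"
  shows "is_hyperbolic {\<sigma> \<in> V. g \<sigma> \<in> S}"
  unfolding is_hyperbolic_def
proof
  fix \<sigma> assume \<sigma>: "\<sigma> \<in> {\<sigma> \<in> V. g \<sigma> \<in> S}"
  then have g\<sigma>: "g \<sigma> \<in> S"
    by simp
  obtain W F where W: "g \<sigma> \<in> W" and loc: "local_equation W F S"
    and hyp: "\<forall>\<tau>\<in>S \<inter> W. F_r F \<tau> * F_t F \<tau> - 1/4 * (F_s F \<tau>)\<^sup>2 < 0"
    using is_hyperbolicE[OF S g\<sigma>] .
  have F: "smooth_on W F"
    using loc by (simp add: local_equation_def)
  have "F_r (\<lambda>\<sigma>. F (g \<sigma>)) \<tau> * F_t (\<lambda>\<sigma>. F (g \<sigma>)) \<tau> - 1/4 * (F_s (\<lambda>\<sigma>. F (g \<sigma>)) \<tau>)\<^sup>2 < 0"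
    if \<tau>: "\<tau> \<in> V" "g \<tau> \<in> S \<inter> W" for \<tau>
  proof -
    let ?L = "frechet_derivative F (at (g \<tau>))" and ?G = "frechet_derivative g (at \<tau>)"
    have L: "linear ?L" and G: "linear ?G"
      using \<tau> by (auto intro: has_derivative_linear smooth_on_has_derivative[OF F] smooth_on_has_derivative[OF g])
    obtain u u' where u: "u \<in> rank_one_directions" "u' \<in> rank_one_directions" "?L u = 0" "?L u' = 0"
      "u \<noteq> 0" "\<forall>c. u' \<noteq> c *\<^sub>R u"
      using hyperbolic_imp_isotropic_pair[OF L bspec[OF hyp \<tau>(2), unfolded F_r_def F_s_def F_t_def]] .
    obtain n where n: "n \<in> vertical" "?L n \<noteq> 0"
      using hyperbolic_imp_nonzero_vertical[OF bspec[OF hyp \<tau>(2)]] .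
    have lin: "linear (\<lambda>v. ?L (?G v))"
      using linear_compose[OF G L] by (simp add: o_def)
    \<comment> \<open>The differential of \<open>g\<close> would turn a proportionality of the lifts
      into one of \<open>u\<close> and \<open>u'\<close>.\<close>
    have "B \<tau> u' \<noteq> c *\<^sub>R B \<tau> u" for c
      using spec[OF u(6), of c] g\<phi>[OF \<tau>(1), of u'] g\<phi>[OF \<tau>(1), of u] by (metis G linear_scale)
    moreover have "B \<tau> u \<noteq> 0"
      using u(5) g\<phi>[OF \<tau>(1), of u] G by (metis linear_0)
    ultimately have "?L (?G (0, 1, 0, 0)) * ?L (?G (0, 0, 0, 1)) - 1/4 * (?L (?G (0, 0, 1, 0)))\<^sup>2 < 0"
      using u n coneB[OF \<tau>(1)] g\<phi>[OF \<tau>(1)]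
        linear_vertical_if_rank_one_directions[OF linB[OF \<tau>(1)] coneB[OF \<tau>(1)] n(1)]
      by (intro isotropic_pair_imp_hyperbolic[OF lin, of "B \<tau> u" "B \<tau> u'" "B \<tau> n"]) auto
    then show ?thesis
      using \<tau> by (simp add: F_r_def F_s_def F_t_def frechet_derivative_compose_at[OF g _ F])
  qed
  moreover have "local_equation (V \<inter> g -` W) (\<lambda>\<sigma>. F (g \<sigma>)) {\<sigma> \<in> V. g \<sigma> \<in> S}"
    using g\<phi> by (intro local_equation_pullback[OF V g loc]) (metis surjI)
  ultimately show "\<exists>W F. \<sigma> \<in> W \<and> local_equation W F {\<sigma> \<in> V. g \<sigma> \<in> S} \<and>
     (\<forall>\<tau>\<in>{\<sigma> \<in> V. g \<sigma> \<in> S} \<inter> W. F_r F \<tau> * F_t F \<tau> - 1/4 * (F_s F \<tau>)\<^sup>2 < 0)"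
    using \<sigma> W by (intro exI[of _ "V \<inter> g -` W"] exI[of _ "\<lambda>\<sigma>. F (g \<sigma>)"]) auto
qed

section \<open>Monge-Ampere equations\<close>

text \<open>
  The two-form \<open>a dp \<and> dq + b dp \<and> dy + c dq \<and> dy + d dx \<and> dq + e dx \<and> dy\<close>: a Monge-Ampere equation
  says that it vanishes on the plane of a point of \<open>J\<^sup>2\<close>.
\<close>

fun monge_ampere_form :: "real \<Rightarrow> real \<Rightarrow> real \<Rightarrow> real \<Rightarrow> real \<Rightarrow> jet1 \<Rightarrow> jet1 \<Rightarrow> real" where
  "monge_ampere_form a b c d e (x, y, z, p, q) (x', y', z', p', q') =
    a * (p * q' - p' * q) + b * (p * y' - p' * y) + c * (q * y' - q' * y) + d * (x * q' - x' * q) +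
    e * (x * y' - x' * y)"

lemma bilinear_monge_ampere_form: "bilinear (monge_ampere_form a b c d e)"
  by (simp add: bilinear_def linear_iff split_paired_all algebra_simps)

lemma monge_ampere_form_self: "monge_ampere_form a b c d e u u = 0"
  by (cases u) simp

text \<open>The lift of the \<open>x\<close> direction to the contact distribution, split as a
  constant plus a scalar function times a constant so that its image under a varying linear map is
  visibly smooth.\<close>

definition horizontal_x :: "jet1 \<Rightarrow> jet1" where
  "horizontal_x \<xi> = (1, 0, 0, 0, 0) + fst (snd (snd (snd \<xi>))) *\<^sub>R (0, 0, 1, 0, 0)"

definition horizontal_y :: "jet1 \<Rightarrow> jet1" where
  "horizontal_y \<xi> = (0, 1, 0, 0, 0) + snd (snd (snd (snd \<xi>))) *\<^sub>R (0, 0, 1, 0, 0)"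

text \<open>The plane has the basis \<open>X + r P + s Q\<close>, \<open>Y + s P + t Q\<close>.
  Hence every two-form, not only one of the five-term shape, gives a Monge-Ampere expression; this
  is what makes pulled-back forms usable.\<close>

lemma alternating_form_vanishes_on_plane_iff:
  fixes \<omega> :: "jet1 \<Rightarrow> jet1 \<Rightarrow> real" and \<xi> :: jet1
  defines "X \<equiv> horizontal_x \<xi>" and "Y \<equiv> horizontal_y \<xi>"
    and "P \<equiv> (0, 0, 0, 1, 0)" and "Q \<equiv> (0, 0, 0, 0, 1)"
  assumes bil: "bilinear \<omega>" and alt: "\<And>u. \<omega> u u = 0"
  shows "(\<forall>u\<in>plane_of (\<xi>, r, s, t). \<forall>v\<in>plane_of (\<xi>, r, s, t). \<omega> u v = 0) \<longleftrightarrow>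
    \<omega> P Q * (r * t - s\<^sup>2) + \<omega> P Y * r + (\<omega> X P + \<omega> Q Y) * s + \<omega> X Q * t + \<omega> X Y = 0"
proof -
  obtain x y z p q where \<xi>: "\<xi> = (x, y, z, p, q)"
    by (metis prod.collapse)
  define u v where uv: "u = X + r *\<^sub>R P + s *\<^sub>R Q" "v = Y + s *\<^sub>R P + t *\<^sub>R Q"
  note bil_simps = bilinear_ladd[OF bil] bilinear_radd[OF bil] bilinear_lmul[OF bil] bilinear_rmul[OF bil]
  have anti: "\<omega> v u = - \<omega> u v" for u v
    using alt[of "u + v"] alt[of u] alt[of v] by (simp add: bil_simps)
  have plane: "plane_of (\<xi>, r, s, t) = {k *\<^sub>R u + l *\<^sub>R v | k l. True}"
    by (auto simp: \<xi> plane_of_explicit uv X_def Y_def P_def Q_def horizontal_x_def horizontal_y_def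
        algebra_simps)
  have comb: "\<omega> (k *\<^sub>R u + l *\<^sub>R v) (k' *\<^sub>R u + l' *\<^sub>R v) = (k * l' - l * k') * \<omega> u v" for k l k' l'
    by (simp add: bil_simps alt anti[of v u] algebra_simps)
  have "1 *\<^sub>R u + 0 *\<^sub>R v \<in> plane_of (\<xi>, r, s, t)" "0 *\<^sub>R u + 1 *\<^sub>R v \<in> plane_of (\<xi>, r, s, t)"
    unfolding plane by blast+
  then have "u \<in> plane_of (\<xi>, r, s, t)" "v \<in> plane_of (\<xi>, r, s, t)"
    by simp_all
  moreover have "\<forall>u\<in>plane_of (\<xi>, r, s, t). \<forall>v\<in>plane_of (\<xi>, r, s, t). \<omega> u v = 0" if "\<omega> u v = 0"
    unfolding plane using comb that by force
  ultimately have "(\<forall>u\<in>plane_of (\<xi>, r, s, t). \<forall>v\<in>plane_of (\<xi>, r, s, t). \<omega> u v = 0) \<longleftrightarrow> \<omega> u v = 0"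
    by blast
  also have "\<omega> u v = \<omega> P Q * (r * t - s\<^sup>2) + \<omega> P Y * r + (\<omega> X P + \<omega> Q Y) * s + \<omega> X Q * t + \<omega> X Y"
    by (simp add: uv bil_simps alt anti[of Q P] power2_eq_square algebra_simps)
  finally show ?thesis .
qed

lemma monge_ampere_form_vanishes_on_plane_iff:
  "(\<forall>u\<in>plane_of (\<xi>, r, s, t). \<forall>v\<in>plane_of (\<xi>, r, s, t). monge_ampere_form a b c d e u v = 0) \<longleftrightarrow>
    a * (r * t - s\<^sup>2) + b * r + c * s + d * t + e = 0"
  unfolding alternating_form_vanishes_on_plane_iff[OF bilinear_monge_ampere_form monge_ampere_form_self]
  by (simp add: horizontal_x_def horizontal_y_def)

lemma smooth_on_monge_ampere_form:
  assumes "open U" "smooth_on U a" "smooth_on U b" "smooth_on U c" "smooth_on U d" "smooth_on U e"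
    "smooth_on U u" "smooth_on U v"
  shows "smooth_on U (\<lambda>\<xi>. monge_ampere_form (a \<xi>) (b \<xi>) (c \<xi>) (d \<xi>) (e \<xi>) (u \<xi>) (v \<xi>))"
proof -
  have "monge_ampere_form a b c d e u v =
      a * (fst (snd (snd (snd u))) * snd (snd (snd (snd v))) - fst (snd (snd (snd v))) * snd (snd (snd (snd u)))) +
      b * (fst (snd (snd (snd u))) * fst (snd v) - fst (snd (snd (snd v))) * fst (snd u)) +
      c * (snd (snd (snd (snd u))) * fst (snd v) - snd (snd (snd (snd v))) * fst (snd u)) +
      d * (fst u * snd (snd (snd (snd v))) - fst v * snd (snd (snd (snd u)))) +
      e * (fst u * fst (snd v) - fst v * fst (snd u))" for a b c d e u v
    by (cases u; cases v) simp
  then show ?thesis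
    using assms
    by (simp only:) (intro smooth_on_add smooth_on_diff smooth_on_bilinear[OF _ bounded_bilinear_mult]
        smooth_on_bounded_linear[OF _ bounded_linear_fst] smooth_on_bounded_linear[OF _ bounded_linear_snd])
qed

text \<open>The vertical part of a canonical vector is unconstrained, so the projection fills the
  plane.\<close>

lemma canonical_system_fst_image: "fst ` canonical_system \<sigma> = plane_of \<sigma>"
  unfolding canonical_system_tautological[abs_def] set_eq_iff image_iff
  by (metis canonical_system_tautological fst_conv)

lemma is_monge_ampereE:
  assumes "is_monge_ampere S" "\<sigma> \<in> S"
  obtains W a b c d e where "\<sigma> \<in> W" "open W"
    "smooth_on (fst ` W) a" "smooth_on (fst ` W) b" "smooth_on (fst ` W) c"
    "smooth_on (fst ` W) d" "smooth_on (fst ` W) e"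
    "S \<inter> W = {(\<xi>, r, s, t). (\<xi>, r, s, t) \<in> W \<and>
       a \<xi> * (r * t - s\<^sup>2) + b \<xi> * r + c \<xi> * s + d \<xi> * t + e \<xi> = 0}"
proof -
  show thesis
    using assms(1)[unfolded is_monge_ampere_def, rule_format, OF assms(2)]
    by (elim exE conjE) (rule that)
qed

text \<open>The new coefficients are those of the two-form pulled back along the map \<psi> covered
  by \<open>g\<close>; they depend on \<xi> alone because \<psi> does.\<close>

lemma is_monge_ampere_pullback:
  assumes V: "open V" and g: "smooth_on V g"
    and C: "\<And>\<sigma>. \<sigma> \<in> V \<Longrightarrow>
      frechet_derivative g (at \<sigma>) ` canonical_system \<sigma> = canonical_system (g \<sigma>)"
    and vert: "\<And>\<sigma> v. \<sigma> \<in> V \<Longrightarrow> v \<in> vertical \<Longrightarrow> frechet_derivative g (at \<sigma>) v \<in> vertical"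
    and S: "is_monge_ampere S"
  shows "is_monge_ampere {\<sigma> \<in> V. g \<sigma> \<in> S}"
  unfolding is_monge_ampere_def
proof
  fix \<sigma> assume \<sigma>: "\<sigma> \<in> {\<sigma> \<in> V. g \<sigma> \<in> S}"
  then have g\<sigma>: "g \<sigma> \<in> S"
    by simp
  obtain W a b c d e where W: "g \<sigma> \<in> W" "open W"
    and sm: "smooth_on (fst ` W) a" "smooth_on (fst ` W) b" "smooth_on (fst ` W) c"
      "smooth_on (fst ` W) d" "smooth_on (fst ` W) e"
    and SW: "S \<inter> W = {(\<xi>, r, s, t). (\<xi>, r, s, t) \<in> W \<and>
       a \<xi> * (r * t - s\<^sup>2) + b \<xi> * r + c \<xi> * s + d \<xi> * t + e \<xi> = 0}"
    using is_monge_ampereE[OF S g\<sigma>] .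
  let ?\<Omega> = "\<lambda>\<xi>. monge_ampere_form (a \<xi>) (b \<xi>) (c \<xi>) (d \<xi>) (e \<xi>)"
  have S_iff: "\<tau> \<in> S \<longleftrightarrow> (\<forall>u\<in>plane_of \<tau>. \<forall>v\<in>plane_of \<tau>. ?\<Omega> (fst \<tau>) u v = 0)" if "\<tau> \<in> W" for \<tau>
  proof -
    obtain \<xi> r s t where \<tau>: "\<tau> = (\<xi>, r, s, t)"
      by (metis prod.collapse)
    have "\<tau> \<in> S \<longleftrightarrow> \<tau> \<in> S \<inter> W"
      using that by blast
    then show ?thesis
      using that unfolding SW \<tau> fst_conv monge_ampere_form_vanishes_on_plane_iff by simp
  qed
  obtain \<xi>0 w0 where \<sigma>_eq: "\<sigma> = (\<xi>0, w0)"
    by (cases \<sigma>)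
  have "open (V \<inter> g -` W)"
    using continuous_open_preimage[OF smooth_on_imp_continuous_on[OF g] V W(2)] .
  then obtain A B0 where A: "open A" "\<xi>0 \<in> A" and B0: "open B0" "w0 \<in> B0" "A \<times> B0 \<subseteq> V \<inter> g -` W"
    using \<sigma> W(1) unfolding \<sigma>_eq by (elim open_prod_elim[of _ "(\<xi>0, w0)"]) auto
  \<comment> \<open>The fibre factor is shrunk to a ball because convexity turns a zero fibre
    derivative into constancy.\<close>
  obtain \<epsilon> where \<epsilon>: "\<epsilon> > 0" "ball w0 \<epsilon> \<subseteq> B0"
    using B0 open_contains_ball by blast
  define B where "B = ball w0 \<epsilon>"
  have B: "open B" "convex B" "w0 \<in> B" and AB: "A \<times> B \<subseteq> V \<inter> g -` W"
    using \<epsilon> B0 by (auto simp: B_def)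
  define \<psi> where "\<psi> \<xi> = fst (g (\<xi>, w0))" for \<xi>
  have \<psi>: "fst (g (\<xi>, w)) = \<psi> \<xi>" if "\<xi> \<in> A" "w \<in> B" for \<xi> w
  proof -
    have "((\<lambda>w. fst (g (\<xi>, w))) has_derivative (\<lambda>h. 0)) (at w within B)" if "w \<in> B" for w
    proof -
      have mem: "(\<xi>, w) \<in> V"
        using \<open>\<xi> \<in> A\<close> that AB by blast
      have "((\<lambda>w. (\<xi>, w)) has_derivative (\<lambda>h. (0, h))) (at w)"
        by (intro has_derivative_Pair has_derivative_const has_derivative_ident)
      note deriv = has_derivative_fst[OF diff_chain_at[OF this smooth_on_has_derivative[OF g mem]]]
      have zero: "fst (frechet_derivative g (at (\<xi>, w)) (0, h)) = 0" for h
        using vert[OF mem, of "(0, h)"] by (simp add: vertical_def)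
      show ?thesis
        using deriv unfolding o_def zero by (rule has_derivative_at_withinI)
    qed
    from has_derivative_zero_constant[OF B(2) this]
    obtain k where "\<forall>w\<in>B. fst (g (\<xi>, w)) = k"
      by blast
    then show ?thesis
      using that B(3) by (simp add: \<psi>_def)
  qed
  have \<psi>W: "\<psi> ` A \<subseteq> fst ` W"
    using AB B(3) by (auto simp: \<psi>_def)
  have \<psi>_sm: "smooth_on A \<psi>"
  proof -
    have lin: "bounded_linear (\<lambda>\<xi>::jet1. (\<xi>, 0 :: real \<times> real \<times> real))"
      by (simp add: linear_conv_bounded_linear[symmetric] linear_iff)
    have "smooth_on A (\<lambda>\<xi>. (\<xi>, 0) + (0, w0))"
      using A(1) by (intro smooth_on_add smooth_on_const smooth_on_bounded_linear[OF _ lin] smooth_on_id)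
    moreover have "(\<lambda>\<xi>. (\<xi>, 0) + (0, w0)) ` A \<subseteq> V"
      using AB B(3) by auto
    ultimately have "smooth_on A (\<lambda>\<xi>. g ((\<xi>, 0) + (0, w0)))"
      by (intro smooth_on_compose[OF A(1) _ g])
    then show ?thesis
      using smooth_on_bounded_linear[OF A(1) bounded_linear_fst] unfolding \<psi>_def[abs_def] by fastforce
  qed
  let ?D = "\<lambda>\<xi>. frechet_derivative \<psi> (at \<xi>)"
  have linD: "linear (?D \<xi>)" if "\<xi> \<in> A" for \<xi>
    using smooth_on_has_derivative[OF \<psi>_sm that] by (rule has_derivative_linear)
  have plane: "plane_of (g \<tau>) = ?D (fst \<tau>) ` plane_of \<tau>" if \<tau>: "\<tau> \<in> A \<times> B" for \<tau>
  proof -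
    have mem: "\<tau> \<in> V" "fst \<tau> \<in> A"
      using \<tau> AB by auto
    have "((\<lambda>\<tau>. fst (g \<tau>)) has_derivative (\<lambda>v. fst (frechet_derivative g (at \<tau>) v))) (at \<tau>)"
      using smooth_on_has_derivative[OF g mem(1)] by (rule has_derivative_fst)
    then have "((\<lambda>\<tau>. \<psi> (fst \<tau>)) has_derivative (\<lambda>v. fst (frechet_derivative g (at \<tau>) v))) (at \<tau>)"
      using \<psi> by (elim has_derivative_transform_within_open[OF _ open_Times[OF A(1) B(1)] \<tau>]) auto
    \<comment> \<open>Two derivatives of the same map: uniqueness shows that \<open>g\<close> acts
      on planes through the derivative of \<psi>.\<close>
    moreover have "((\<lambda>\<tau>. \<psi> (fst \<tau>)) has_derivative (\<lambda>v. ?D (fst \<tau>) (fst v))) (at \<tau>)"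
      using diff_chain_at[OF has_derivative_fst[OF has_derivative_ident]
          smooth_on_has_derivative[OF \<psi>_sm mem(2)]] by (simp add: o_def)
    ultimately have "fst (frechet_derivative g (at \<tau>) v) = ?D (fst \<tau>) (fst v)" for v
      using has_derivative_unique by metis
    then have "fst ` frechet_derivative g (at \<tau>) ` canonical_system \<tau> = ?D (fst \<tau>) ` fst ` canonical_system \<tau>"
      by (simp add: image_image)
    then show ?thesis
      by (simp add: C[OF mem(1)] canonical_system_fst_image)
  qed
  define \<omega> where "\<omega> \<xi> u v = ?\<Omega> (\<psi> \<xi>) (?D \<xi> u) (?D \<xi> v)" for \<xi> u v
  have bil: "bilinear (\<omega> \<xi>)" if "\<xi> \<in> A" for \<xi>
    unfolding bilinear_def linear_iff \<omega>_def
    by (simp add: linear_add[OF linD[OF that]] linear_scale[OF linD[OF that]]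
        bilinear_ladd[OF bilinear_monge_ampere_form] bilinear_radd[OF bilinear_monge_ampere_form]
        bilinear_lmul[OF bilinear_monge_ampere_form] bilinear_rmul[OF bilinear_monge_ampere_form]
        del: split_paired_All)
  have D_sm: "smooth_on A (\<lambda>\<xi>. ?D \<xi> u)" for u
    using \<psi>_sm by (rule smooth_on_frechet_derivative)
  have \<omega>_sm: "smooth_on A (\<lambda>\<xi>. \<omega> \<xi> (u \<xi>) (v \<xi>))"
    if "smooth_on A (\<lambda>\<xi>. ?D \<xi> (u \<xi>))" "smooth_on A (\<lambda>\<xi>. ?D \<xi> (v \<xi>))" for u v
    unfolding \<omega>_def using that sm
    by (intro smooth_on_monge_ampere_form smooth_on_compose[OF A(1) \<psi>W _ \<psi>_sm] A(1))
  have coord_sm: "smooth_on A (\<lambda>\<xi>. fst (snd (snd (snd \<xi>))))" "smooth_on A (\<lambda>\<xi>. snd (snd (snd (snd \<xi>))))"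
    by (intro smooth_on_bounded_linear[OF A(1) bounded_linear_fst] smooth_on_id[OF A(1)]
        smooth_on_bounded_linear[OF A(1) bounded_linear_snd])+
  \<comment> \<open>The direction varies with the point; linearity reduces it to the fixed
    directions \<open>k\<close> and \<open>l\<close>.\<close>
  have hor_sm: "smooth_on A (\<lambda>\<xi>. ?D \<xi> (k + f \<xi> *\<^sub>R l))" if "smooth_on A f" for f k l
  proof -
    have "smooth_on A (\<lambda>\<xi>. ?D \<xi> k + f \<xi> *\<^sub>R ?D \<xi> l)"
      using A(1) that D_sm by (intro smooth_on_add smooth_on_bilinear[OF _ bounded_bilinear_scaleR])
    then show ?thesis
      by (rule smooth_on_cong[OF A(1), rotated]) (simp add: linear_add[OF linD] linear_scale[OF linD])
  qed
  have X_sm: "smooth_on A (\<lambda>\<xi>. ?D \<xi> (horizontal_x \<xi>))" and Y_sm: "smooth_on A (\<lambda>\<xi>. ?D \<xi> (horizontal_y \<xi>))"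
    unfolding horizontal_x_def horizontal_y_def by (intro hor_sm coord_sm)+
  let ?P = "(0, 0, 0, 1, 0) :: jet1" and ?Q = "(0, 0, 0, 0, 1) :: jet1"
  have iff: "(\<xi>, r, s, t) \<in> {\<sigma> \<in> V. g \<sigma> \<in> S} \<longleftrightarrow> \<omega> \<xi> ?P ?Q * (r * t - s\<^sup>2) + \<omega> \<xi> ?P (horizontal_y \<xi>) * r +
      (\<omega> \<xi> (horizontal_x \<xi>) ?P + \<omega> \<xi> ?Q (horizontal_y \<xi>)) * s + \<omega> \<xi> (horizontal_x \<xi>) ?Q * t +
      \<omega> \<xi> (horizontal_x \<xi>) (horizontal_y \<xi>) = 0"
    if "(\<xi>, r, s, t) \<in> A \<times> B" for \<xi> r s t
  proof -
    have mem: "\<xi> \<in> A" "(\<xi>, r, s, t) \<in> V" "g (\<xi>, r, s, t) \<in> W" "fst (g (\<xi>, r, s, t)) = \<psi> \<xi>"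
      using that AB \<psi> by auto
    have "(\<xi>, r, s, t) \<in> {\<sigma> \<in> V. g \<sigma> \<in> S} \<longleftrightarrow>
        (\<forall>u\<in>plane_of (\<xi>, r, s, t). \<forall>v\<in>plane_of (\<xi>, r, s, t). \<omega> \<xi> u v = 0)"
      using mem S_iff plane[OF that] by (simp add: \<omega>_def)
    also have "\<dots> \<longleftrightarrow> \<omega> \<xi> ?P ?Q * (r * t - s\<^sup>2) + \<omega> \<xi> ?P (horizontal_y \<xi>) * r +
      (\<omega> \<xi> (horizontal_x \<xi>) ?P + \<omega> \<xi> ?Q (horizontal_y \<xi>)) * s + \<omega> \<xi> (horizontal_x \<xi>) ?Q * t +
      \<omega> \<xi> (horizontal_x \<xi>) (horizontal_y \<xi>) = 0"
      by (rule alternating_form_vanishes_on_plane_iff[OF bil[OF mem(1)]]) (simp add: \<omega>_def monge_ampere_form_self)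
    finally show ?thesis .
  qed
  have fstAB: "fst ` (A \<times> B) = A"
    using B(3) by (auto simp: fst_image_times)
  show "\<exists>W a b c d e. \<sigma> \<in> W \<and> open W \<and>
     smooth_on (fst ` W) a \<and> smooth_on (fst ` W) b \<and> smooth_on (fst ` W) c \<and>
     smooth_on (fst ` W) d \<and> smooth_on (fst ` W) e \<and>
     {\<sigma> \<in> V. g \<sigma> \<in> S} \<inter> W = {(\<xi>, r, s, t). (\<xi>, r, s, t) \<in> W \<and>
       a \<xi> * (r * t - s\<^sup>2) + b \<xi> * r + c \<xi> * s + d \<xi> * t + e \<xi> = 0}"
  proof (intro exI conjI)
    show "\<sigma> \<in> A \<times> B" "open (A \<times> B)"
      using A B by (auto simp: \<sigma>_eq open_Times)
    show "smooth_on (fst ` (A \<times> B)) (\<lambda>\<xi>. \<omega> \<xi> ?P ?Q)"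
      "smooth_on (fst ` (A \<times> B)) (\<lambda>\<xi>. \<omega> \<xi> ?P (horizontal_y \<xi>))"
      "smooth_on (fst ` (A \<times> B)) (\<lambda>\<xi>. \<omega> \<xi> (horizontal_x \<xi>) ?P + \<omega> \<xi> ?Q (horizontal_y \<xi>))"
      "smooth_on (fst ` (A \<times> B)) (\<lambda>\<xi>. \<omega> \<xi> (horizontal_x \<xi>) ?Q)"
      "smooth_on (fst ` (A \<times> B)) (\<lambda>\<xi>. \<omega> \<xi> (horizontal_x \<xi>) (horizontal_y \<xi>))"
      unfolding fstAB by (intro smooth_on_add \<omega>_sm A(1) D_sm X_sm Y_sm)+
    show "{\<sigma> \<in> V. g \<sigma> \<in> S} \<inter> A \<times> B = {(\<xi>, r, s, t). (\<xi>, r, s, t) \<in> A \<times> B \<and>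
        \<omega> \<xi> ?P ?Q * (r * t - s\<^sup>2) + \<omega> \<xi> ?P (horizontal_y \<xi>) * r +
      (\<omega> \<xi> (horizontal_x \<xi>) ?P + \<omega> \<xi> ?Q (horizontal_y \<xi>)) * s + \<omega> \<xi> (horizontal_x \<xi>) ?Q * t +
      \<omega> \<xi> (horizontal_x \<xi>) (horizontal_y \<xi>) = 0}"
      (is "?L = ?R")
    proof (rule set_eqI)
      fix \<tau> :: jet2
      obtain \<xi> r s t where \<tau>: "\<tau> = (\<xi>, r, s, t)"
        by (metis prod.collapse)
      show "\<tau> \<in> ?L \<longleftrightarrow> \<tau> \<in> ?R"
        using iff[of \<xi> r s t] unfolding \<tau> mem_Collect_eq case_prod_conv Int_iff by blast
    qed
  qed
qed

section \<open>Transport along a contact transformation\<close>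

theorem theorem4p5:
  fixes U V S :: "jet2 set" and \<phi> :: "jet2 \<Rightarrow> jet2"
  assumes "contact_transformation U V \<phi>"
    and "hyperbolic_monge_ampere_pde S"
  shows "hyperbolic_monge_ampere_pde (\<phi> ` (S \<inter> U))"
proof -
  obtain g where hom: "homeomorphism U V \<phi> g" and g: "smooth_on V g"
    and g\<phi>: "\<And>\<sigma> v. \<sigma> \<in> V \<Longrightarrow> frechet_derivative g (at \<sigma>) (frechet_derivative \<phi> (at (g \<sigma>)) v) = v"
    and Cg: "\<And>\<sigma>. \<sigma> \<in> V \<Longrightarrow>
      frechet_derivative g (at \<sigma>) ` canonical_system \<sigma> = canonical_system (g \<sigma>)"
    using contact_transformation_inverse[OF assms(1)] by metis
  have UV: "open U" "open V" and \<phi>: "smooth_on U \<phi>"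
    and C: "\<And>\<sigma>. \<sigma> \<in> U \<Longrightarrow>
      frechet_derivative \<phi> (at \<sigma>) ` canonical_system \<sigma> = canonical_system (\<phi> \<sigma>)"
    using assms(1) by (auto simp: contact_transformation_def diffeomorphism_between_def)
  have gU: "g \<sigma> \<in> U" if "\<sigma> \<in> V" for \<sigma>
    using hom that by (auto simp: homeomorphism_def)
  \<comment> \<open>Invariance of the cone is used both ways: here the derivative of \<phi> lifts
    cone vectors, while for the Monge-Ampere property the derivative of \<open>g\<close> must keep
    vertical vectors vertical.\<close>
  have "is_hyperbolic {\<sigma> \<in> V. g \<sigma> \<in> S}"
  proof (rule is_hyperbolic_pullback[OF UV(2) g g\<phi>])
    show "linear (frechet_derivative \<phi> (at (g \<sigma>)))" if "\<sigma> \<in> V" for \<sigma>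
      using smooth_on_has_derivative[OF \<phi> gU[OF that]] by (rule has_derivative_linear)
    show "frechet_derivative \<phi> (at (g \<sigma>)) v \<in> rank_one_directions"
      if "\<sigma> \<in> V" "v \<in> rank_one_directions" for \<sigma> v
      using frechet_derivative_rank_one_directions[OF UV(1) \<phi> C gU[OF that(1)] that(2)] .
    show "is_hyperbolic S"
      using assms(2) by (simp add: hyperbolic_monge_ampere_pde_def)
  qed
  moreover have "is_monge_ampere {\<sigma> \<in> V. g \<sigma> \<in> S}"
  proof (rule is_monge_ampere_pullback[OF UV(2) g Cg])
    show "frechet_derivative g (at \<sigma>) v \<in> vertical" if "\<sigma> \<in> V" "v \<in> vertical" for \<sigma> v
      by (rule linear_vertical_if_rank_one_directions[OF
            has_derivative_linear[OF smooth_on_has_derivative[OF g that(1)]]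
            frechet_derivative_rank_one_directions[OF UV(2) g Cg that(1)] that(2)])
    show "is_monge_ampere S"
      using assms(2) by (simp add: hyperbolic_monge_ampere_pde_def)
  qed
  ultimately show ?thesis
    unfolding hyperbolic_monge_ampere_pde_def contact_image_eq_preimage[OF hom]
    using is_pde_if_is_hyperbolic by blast
qed

end
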